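(* Let $n\ge3$. The isolated subsemigroups of $\mathcal{PI}^{\ast}_n$ are exactly the following: (1) $\mathcal{I}^{\ast}_n$, $\mathcal{I}^{\ast}_n\setminus\mathcal{S}_n$, $\mathcal{S}_n$, and $G(e)$ for $e$ an idempotent of $\mathcal{I}^{\ast}_n$ of rank $n-1$; (2) for each $t\in\{1,\dots,n\}$ and $Y=\{1,\dots,n\}\setminus\{t\}$: $\mathcal{I}^{\ast}_Y$, $\mathcal{I}^{\ast}_Y\setminus\mathcal{S}_Y$, $\mathcal{S}_Y$, and $G(e)$ for $e$ an idempotent of $\mathcal{I}^{\ast}_Y$ of rank $n-2$; (3) $\mathcal{PI}^{\ast}_n$ and $\mathcal{PI}^{\ast}_n\setminus\mathcal{S}_n$.
   Context: Let $X=\{1,\dots,n\}$, $X'=\{1',\dots,n'\}$. $\mathcal{PI}^{\ast}_n$ is the set of partitions of $X\cup X'$ each of whose blocks is a singleton (point) or a generalised line (a set meeting both $X$ and $X'$), with product $\star$: with $X''$ a third copy of $X$, regard $\alpha$ as a partition of $X\cup X''$ and $\beta$ as a partition of $X''\cup X'$, let $\sim$ be the equivalence on $X\cup X''\cup X'$ generated by the blocks of both; $\alpha\star\beta$ is the partition of $X\cup X'$ in which distinct $u,v$ are in one block iff $u\sim v$ and the $\sim$-class of $u$ contains no singleton block of $\alpha$ or $\beta$. Rank = number of generalised lines. $\mathcal{I}^{\ast}_n$ = elements with no points; $\mathcal{S}_n$ = group of units (all blocks of the form $\{x,\pi(x)'\}$, $\pi$ a permutation). For $Y=X\setminus\{t\}$,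 $\mathcal{I}^{\ast}_Y$ is the set of elements of $\mathcal{PI}^{\ast}_n$ whose points are exactly $\{t\}$ and $\{t'\}$ (so the generalised lines partition $Y\cup Y'$), and $\mathcal{S}_Y$ the set of those whose other blocks are $\{y,\pi(y)'\}$ for a permutation $\pi$ of $Y$; these are subsemigroups. $G(e)$ is the $\mathcal{H}$-class (in $\mathcal{PI}^{\ast}_n$) of the idempotent $e$. A subsemigroup $T$ of $S$ is isolated if for all $a\in S$, $k\ge 1$, $a^k\in T$ implies $a\in T$. *)

theory Defs
  imports "HOL-Combinatorics.Permutations"
begin

text \<open>Points of X are Inl i, points of X' are Inr i, with i in {1..n}.
  An element of PI*_n is a set of blocks (a partition of X union X').\<close>

definition carrier :: "nat \<Rightarrow> (nat + nat) set" where
  "carrier n = Inl ` {1..n} \<union> Inr ` {1..n}"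

definition is_partition :: "nat \<Rightarrow> (nat + nat) set set \<Rightarrow> bool" where
  "is_partition n P \<longleftrightarrow> (\<forall>B\<in>P. B \<noteq> {}) \<and>
     (\<forall>B\<in>P. \<forall>C\<in>P. B \<noteq> C \<longrightarrow> B \<inter> C = {}) \<and> \<Union>P = carrier n"

definition is_point :: "(nat + nat) set \<Rightarrow> bool" where
  "is_point B \<longleftrightarrow> (\<exists>x. B = {x})"

definition is_gline :: "(nat + nat) set \<Rightarrow> bool" where
  "is_gline B \<longleftrightarrow> B \<inter> range Inl \<noteq> {} \<and> B \<inter> range Inr \<noteq> {}"

definition PIstar :: "nat \<Rightarrow> (nat + nat) set set set" where
  "PIstar n = {P. is_partition n P \<and> (\<forall>B\<in>P. is_point B \<or> is_gline B)}"

definition rank :: "(nat + nat) set set \<Rightarrow> nat" where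
  "rank P = card {B\<in>P. is_gline B}"

text \<open>The product: X = tag 0, X'' = tag 1, X' = tag 2.\<close>

fun emb1 :: "nat + nat \<Rightarrow> nat \<times> nat" where
  "emb1 (Inl x) = (0, x)" | "emb1 (Inr x) = (1, x)"

fun emb2 :: "nat + nat \<Rightarrow> nat \<times> nat" where
  "emb2 (Inl x) = (1, x)" | "emb2 (Inr x) = (2, x)"

fun embo :: "nat + nat \<Rightarrow> nat \<times> nat" where
  "embo (Inl x) = (0, x)" | "embo (Inr x) = (2, x)"

definition gen_rel :: "(nat + nat) set set \<Rightarrow> (nat + nat) set set \<Rightarrow> nat \<times> nat \<Rightarrow> nat \<times> nat \<Rightarrow> bool" where
  "gen_rel a b z w \<longleftrightarrow> (\<exists>B\<in>a. z \<in> emb1 ` B \<and> w \<in> emb1 ` B) \<or> (\<exists>B\<in>b. z \<in> emb2 ` B \<and> w \<in> emb2 ` B)"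

definition sim :: "(nat + nat) set set \<Rightarrow> (nat + nat) set set \<Rightarrow> nat \<times> nat \<Rightarrow> nat \<times> nat \<Rightarrow> bool" where
  "sim a b = (gen_rel a b)\<^sup>*\<^sup>*"

definition has_point_in_class :: "(nat + nat) set set \<Rightarrow> (nat + nat) set set \<Rightarrow> nat \<times> nat \<Rightarrow> bool" where
  "has_point_in_class a b z \<longleftrightarrow>
     (\<exists>B\<in>a. is_point B \<and> emb1 ` B \<subseteq> {w. sim a b z w}) \<or>
     (\<exists>B\<in>b. is_point B \<and> emb2 ` B \<subseteq> {w. sim a b z w})"

definition star :: "nat \<Rightarrow> (nat + nat) set set \<Rightarrow> (nat + nat) set set \<Rightarrow> (nat + nat) set set" where
  "star n a b = (\<lambda>u. if has_point_in_class a b (embo u) then {u}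
                      else {v \<in> carrier n. sim a b (embo u) (embo v)}) ` carrier n"

definition spow :: "nat \<Rightarrow> (nat + nat) set set \<Rightarrow> nat \<Rightarrow> (nat + nat) set set" where
  "spow n a k = ((\<lambda>x. star n x a) ^^ (k - 1)) a"   \<comment> \<open>a^k for k \<ge> 1\<close>

definition Istar :: "nat \<Rightarrow> (nat + nat) set set set" where
  "Istar n = {P \<in> PIstar n. \<forall>B\<in>P. is_gline B}"

definition Sn :: "nat \<Rightarrow> (nat + nat) set set set" where
  "Sn n = {P \<in> PIstar n. \<exists>\<pi>. \<pi> permutes {1..n} \<and> P = (\<lambda>x. {Inl x, Inr (\<pi> x)}) ` {1..n}}"

definition IY :: "nat \<Rightarrow> nat \<Rightarrow> (nat + nat) set set set" where
  "IY n t = {P \<in> PIstar n. {Inl t} \<in> P \<and> {Inr t} \<in> P \<and>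
      (\<forall>B\<in>P. B \<noteq> {Inl t} \<and> B \<noteq> {Inr t} \<longrightarrow> is_gline B)}"

definition SY :: "nat \<Rightarrow> nat \<Rightarrow> (nat + nat) set set set" where
  "SY n t = {P \<in> PIstar n. \<exists>\<pi>. \<pi> permutes ({1..n} - {t}) \<and>
      P = insert {Inl t} (insert {Inr t} ((\<lambda>y. {Inl y, Inr (\<pi> y)}) ` ({1..n} - {t})))}"

text \<open>Green's relations in the semigroup (PIstar n, star n), using S^1.\<close>

definition Rrel :: "nat \<Rightarrow> (nat + nat) set set \<Rightarrow> (nat + nat) set set \<Rightarrow> bool" where
  "Rrel n a b \<longleftrightarrow> (a = b \<or> (\<exists>x\<in>PIstar n. a = star n b x)) \<and> (b = a \<or> (\<exists>x\<in>PIstar n. b = star n a x))"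

definition Lrel :: "nat \<Rightarrow> (nat + nat) set set \<Rightarrow> (nat + nat) set set \<Rightarrow> bool" where
  "Lrel n a b \<longleftrightarrow> (a = b \<or> (\<exists>x\<in>PIstar n. a = star n x b)) \<and> (b = a \<or> (\<exists>x\<in>PIstar n. b = star n x a))"

definition Gclass :: "nat \<Rightarrow> (nat + nat) set set \<Rightarrow> (nat + nat) set set set" where
  "Gclass n e = {a \<in> PIstar n. Rrel n a e \<and> Lrel n a e}"

definition idem :: "nat \<Rightarrow> (nat + nat) set set \<Rightarrow> bool" where
  "idem n e \<longleftrightarrow> star n e e = e"

definition isolated_subsemigroup :: "nat \<Rightarrow> (nat + nat) set set set \<Rightarrow> bool" where
  "isolated_subsemigroup n T \<longleftrightarrow> T \<noteq> {} \<and> T \<subseteq> PIstar n \<and>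
     (\<forall>a\<in>T. \<forall>b\<in>T. star n a b \<in> T) \<and>
     (\<forall>a\<in>PIstar n. \<forall>k\<ge>1. spow n a k \<in> T \<longrightarrow> a \<in> T)"

end

theory Submission
  imports Defs
begin

text \<open>Call a pair \<open>(A, B)\<close> of subsets of \<open>{1..n}\<close> related by \<open>a\<close> if the copy of \<open>A\<close> in \<open>X\<close> together with the
copy of \<open>B\<close> in \<open>X'\<close> is a union of generalised lines of \<open>a\<close>.  This embeds the semigroup into the partial
bijections of the power set, the product becoming relational composition and an idempotent becoming
the identity on a ring of sets \<open>D\<close>; equivalently, \<open>D\<close> is a partition of \<open>{0..n}\<close> whose class of \<open>0\<close>
collects the points.  Products of idempotents are intersections of rings.

An isolated semigroup \<open>T\<close> is determined by its idempotents and closed under inverses.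
If \<open>a\<close> is a square root of an idempotent in \<open>T\<close> that lies outside its group, then the idempotents on
the domain and on the range of \<open>a\<close> are strictly larger and lie in \<open>T\<close>.  Such roots split any class with at
least three elements, and split one of two nontrivial classes avoiding \<open>0\<close>.  Conjugation by
the maximal subgroups permutes the classes other than that of \<open>0\<close>.  Playing
splitting and conjugation against the minimality of the least idempotent of \<open>T\<close> leaves only the
listed cases.\<close>

section \<open>The faithful representation by relations on subsets\<close>

text \<open>Relational composition on unions of lines replaces the generated equivalence of the
  product, so inverses and idempotent powers become elementary. Adjoining 0 turns the points into
  one more class: deleting a line and merging two lines are then the same operation. The remaining
  asymmetry, that no conjugation moves the class of 0, separates the families of the list. The
  decisive number is how many elements of {1..n} the union \<open>Y\<close> of the least ring omits.
  If it omits two, one of them can be split off as a new class, and interchanging it with any class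
  inside \<open>Y\<close> contradicts minimality; hence \<open>Y\<close> is empty and the zero
  element is present. The converse has the same threshold: if \<open>Y\<close> omits s and t, the
  partial bijection that is the identity on \<open>Y\<close> and sends s to t has its square in
  \<open>M_rel n Y\<close> but is not there itself. The bound n \<ge> 3 leaves two elements in
  \<open>Y\<close> even when one is omitted; for a one-element \<open>Y\<close> the set
  \<open>M_rel n Y - H_rel n (Pow Y)\<close> would be empty.\<close>

definition lines :: "(nat + nat) set set \<Rightarrow> (nat + nat) set set" where
  "lines a = {B \<in> a. is_gline B}"

definition line_rel :: "(nat + nat) set set \<Rightarrow> (nat set \<times> nat set) set" where
  "line_rel a = (\<lambda>F. (Inl -` \<Union>F, Inr -` \<Union>F)) ` Pow (lines a)"

lemma point_not_gline: "is_point B \<Longrightarrow> \<not> is_gline B"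
  by (auto simp: is_point_def is_gline_def)

lemma PIstar_disjoint:
  assumes "a \<in> PIstar n" "B \<in> a" "C \<in> a" "u \<in> B" "u \<in> C"
  shows "B = C"
  using assms unfolding PIstar_def is_partition_def by blast

lemma PIstar_block_nonempty: "a \<in> PIstar n \<Longrightarrow> B \<in> a \<Longrightarrow> B \<noteq> {}"
  unfolding PIstar_def is_partition_def by blast

lemma PIstar_block_subset: "a \<in> PIstar n \<Longrightarrow> B \<in> a \<Longrightarrow> B \<subseteq> carrier n"
  unfolding PIstar_def is_partition_def by blast

lemma PIstar_block_exists: "a \<in> PIstar n \<Longrightarrow> u \<in> carrier n \<Longrightarrow> \<exists>B\<in>a. u \<in> B"
  unfolding PIstar_def is_partition_def by (auto dest: equalityD2)

lemma PIstar_block_cases: "a \<in> PIstar n \<Longrightarrow> B \<in> a \<Longrightarrow> is_point B \<or> is_gline B"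
  unfolding PIstar_def by blast

lemma carrier_iff [simp]: "Inl x \<in> carrier n \<longleftrightarrow> x \<in> {1..n}" "Inr x \<in> carrier n \<longleftrightarrow> x \<in> {1..n}"
  by (auto simp: carrier_def)

lemma finite_carrier: "finite (carrier n)"
  by (simp add: carrier_def)

lemma finite_PIstar_elem: "a \<in> PIstar n \<Longrightarrow> finite a"
  by (rule finite_subset[of _ "Pow (carrier n)"]) (auto simp: finite_carrier dest: PIstar_block_subset)

lemma Inl_Inr_vimage: "Inl ` (Inl -` D) \<union> Inr ` (Inr -` D) = D"
proof -
  have "u \<in> Inl ` (Inl -` D) \<union> Inr ` (Inr -` D)" if "u \<in> D" for u
    using that by (cases u) auto
  then show ?thesis by auto
qed

text \<open>No set of lines has to be chosen in this form: membership is checked one block at a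
  time.\<close>

lemma line_rel_iff:
  assumes a: "a \<in> PIstar n"
  shows "(A, B) \<in> line_rel a \<longleftrightarrow> A \<subseteq> {1..n} \<and> B \<subseteq> {1..n} \<and>
    (\<forall>K\<in>a. K \<subseteq> Inl ` A \<union> Inr ` B \<and> is_gline K \<or> K \<inter> (Inl ` A \<union> Inr ` B) = {})"
    (is "_ \<longleftrightarrow> ?R")
proof
  assume "(A, B) \<in> line_rel a"
  then obtain F where F: "F \<subseteq> lines a" "A = Inl -` \<Union>F" "B = Inr -` \<Union>F"
    by (auto simp: line_rel_def)
  have D: "Inl ` A \<union> Inr ` B = \<Union>F"
    using F Inl_Inr_vimage by metis
  have Fa: "F \<subseteq> a" using F(1) by (auto simp: lines_def)
  then have "\<Union>F \<subseteq> carrier n" using PIstar_block_subset[OF a] by blast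
  then have "A \<subseteq> {1..n}" "B \<subseteq> {1..n}" using F(2,3) carrier_iff by blast+
  moreover have "K \<subseteq> \<Union>F \<and> is_gline K \<or> K \<inter> \<Union>F = {}" if "K \<in> a" for K
  proof (cases "K \<in> F")
    case True
    then show ?thesis using F(1) by (auto simp: lines_def)
  next
    case False
    then show ?thesis using PIstar_disjoint[OF a that] Fa by blast
  qed
  ultimately show ?R using D by simp
next
  assume R: ?R
  define D where "D = Inl ` A \<union> Inr ` B"
  define F where "F = {K \<in> a. K \<subseteq> D \<and> is_gline K}"
  have "\<Union>F = D"
  proof
    show "\<Union>F \<subseteq> D" by (auto simp: F_def)
    show "D \<subseteq> \<Union>F"
    proof
      fix u assume u: "u \<in> D"
      have "D \<subseteq> carrier n" using R by (auto simp: D_def carrier_def)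
      then obtain K where K: "K \<in> a" "u \<in> K" using PIstar_block_exists[OF a] u by blast
      then have "K \<in> F" using R u unfolding F_def D_def by blast
      then show "u \<in> \<Union>F" using K by blast
    qed
  qed
  then have "A = Inl -` \<Union>F" "B = Inr -` \<Union>F" by (auto simp: D_def)
  moreover have "F \<in> Pow (lines a)" by (auto simp: F_def lines_def)
  ultimately show "(A, B) \<in> line_rel a" unfolding line_rel_def by blast
qed

lemma line_rel_line:
  assumes "K \<in> lines a"
  shows "(Inl -` K, Inr -` K) \<in> line_rel a"
  using assms unfolding line_rel_def by (auto intro!: image_eqI[of _ _ "{K}"])

text \<open>Lines are the minimal nonempty unions of lines. A line of \<open>a\<close> contains a
  line of \<open>b\<close>, which contains a line of \<open>a\<close>; disjointness of blocks makes
  the outer two equal and squeezes the middle one.\<close>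

lemma lines_subset_if_line_rel_eq:
  assumes a: "a \<in> PIstar n" and b: "b \<in> PIstar n" and eq: "line_rel a = line_rel b"
  shows "lines a \<subseteq> lines b"
proof
  have sub: "\<exists>K'\<in>lines d. K' \<subseteq> K"
    if c: "c \<in> PIstar n" and cd: "line_rel c = line_rel d" and K: "K \<in> lines c" for c d K
  proof -
    obtain F where F: "F \<subseteq> lines d" "Inl -` K = Inl -` \<Union>F" "Inr -` K = Inr -` \<Union>F"
      using line_rel_line[OF K] cd by (auto simp: line_rel_def)
    then have KF: "K = \<Union>F" using Inl_Inr_vimage by metis
    moreover have "K \<noteq> {}" using PIstar_block_nonempty[OF c] K by (auto simp: lines_def)
    ultimately show ?thesis using F(1) by blast
  qed
  fix K assume K: "K \<in> lines a"
  obtain K' where K': "K' \<in> lines b" "K' \<subseteq> K" using sub[OF a eq K] by blast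
  obtain K'' where K'': "K'' \<in> lines a" "K'' \<subseteq> K'" using sub[OF b eq[symmetric] K'(1)] by blast
  have "K'' \<noteq> {}" using PIstar_block_nonempty[OF a] K'' by (auto simp: lines_def)
  then have "K'' = K" using PIstar_disjoint[OF a] K'' K' K unfolding lines_def by blast
  then show "K \<in> lines b" using K' K'' by auto
qed

text \<open>Completes injectivity: once the lines are known, the blocks that remain can only be
  singletons.\<close>

lemma PIstar_eq_lines_points:
  assumes a: "a \<in> PIstar n"
  shows "a = lines a \<union> (\<lambda>u. {u}) ` (carrier n - \<Union>(lines a))"
proof (intro equalityI subsetI)
  fix K assume K: "K \<in> a"
  show "K \<in> lines a \<union> (\<lambda>u. {u}) ` (carrier n - \<Union>(lines a))"
  proof (cases "is_gline K")
    case False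
    then obtain u where u: "K = {u}"
      using PIstar_block_cases[OF a K] by (auto simp: is_point_def)
    have "u \<in> carrier n" using PIstar_block_subset[OF a K] u by blast
    moreover have "u \<notin> \<Union>(lines a)"
      using PIstar_disjoint[OF a K] u False by (auto simp: lines_def)
    ultimately show ?thesis using u by blast
  qed (simp add: K lines_def)
next
  fix K assume K: "K \<in> lines a \<union> (\<lambda>u. {u}) ` (carrier n - \<Union>(lines a))"
  show "K \<in> a"
  proof (cases "K \<in> lines a")
    case False
    then obtain u where u: "K = {u}" "u \<in> carrier n" "u \<notin> \<Union>(lines a)" using K by blast
    obtain C where C: "C \<in> a" "u \<in> C" using PIstar_block_exists[OF a u(2)] by blast
    then have "is_point C" using PIstar_block_cases[OF a C(1)] u(3) by (auto simp: lines_def)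
    then show ?thesis using C u(1) by (auto simp: is_point_def)
  qed (simp add: lines_def)
qed

lemma inj_on_line_rel: "inj_on line_rel (PIstar n)"
proof (rule inj_onI)
  fix a b assume ab: "a \<in> PIstar n" "b \<in> PIstar n" "line_rel a = line_rel b"
  then have "lines a = lines b"
    using lines_subset_if_line_rel_eq[of a n b] lines_subset_if_line_rel_eq[of b n a] by simp
  then show "a = b" using PIstar_eq_lines_points ab by metis
qed

section \<open>The product as relational composition\<close>

lemma gen_rel_sym: "gen_rel a b z w \<Longrightarrow> gen_rel a b w z"
  unfolding gen_rel_def by blast

lemma sim_refl [simp]: "sim a b z z"
  by (simp add: sim_def)

lemma sim_sym: "sim a b z w \<Longrightarrow> sim a b w z"
  unfolding sim_def
  by (rule sympD[OF symp_rtranclp]) (auto intro: sympI gen_rel_sym)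

lemma sim_trans: "sim a b z w \<Longrightarrow> sim a b w v \<Longrightarrow> sim a b z v"
  unfolding sim_def by simp

lemma sim_emb1: "K \<in> a \<Longrightarrow> u \<in> K \<Longrightarrow> v \<in> K \<Longrightarrow> sim a b (emb1 u) (emb1 v)"
  unfolding sim_def gen_rel_def by blast

lemma sim_emb2: "K \<in> b \<Longrightarrow> u \<in> K \<Longrightarrow> v \<in> K \<Longrightarrow> sim a b (emb2 u) (emb2 v)"
  unfolding sim_def gen_rel_def by blast

lemma sim_closed:
  assumes "sim a b z w" "z \<in> D" "\<And>z w. gen_rel a b z w \<Longrightarrow> z \<in> D \<Longrightarrow> w \<in> D"
  shows "w \<in> D"
  using assms(1,2) unfolding sim_def by (induction rule: rtranclp_induct) (auto intro: assms(3))

lemma has_point_sim: "sim a b z w \<Longrightarrow> has_point_in_class a b z \<longleftrightarrow> has_point_in_class a b w"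
proof -
  assume "sim a b z w"
  then have "{v. sim a b z v} = {v. sim a b w v}" by (blast intro: sim_sym sim_trans)
  then show ?thesis by (simp add: has_point_in_class_def)
qed

lemma has_pointI1: "K \<in> a \<Longrightarrow> is_point K \<Longrightarrow> u \<in> K \<Longrightarrow> sim a b z (emb1 u) \<Longrightarrow> has_point_in_class a b z"
  unfolding has_point_in_class_def is_point_def by blast

lemma has_pointI2: "K \<in> b \<Longrightarrow> is_point K \<Longrightarrow> u \<in> K \<Longrightarrow> sim a b z (emb2 u) \<Longrightarrow> has_point_in_class a b z"
  unfolding has_point_in_class_def is_point_def by blast

definition star_block :: "nat \<Rightarrow> (nat + nat) set set \<Rightarrow> (nat + nat) set set \<Rightarrow> nat + nat \<Rightarrow> (nat + nat) set" where
  "star_block n a b u = (if has_point_in_class a b (embo u) then {u}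
                      else {v \<in> carrier n. sim a b (embo u) (embo v)})"

lemma star_eq: "star n a b = star_block n a b ` carrier n"
  by (simp add: star_def star_block_def)

lemma star_block_self: "u \<in> carrier n \<Longrightarrow> u \<in> star_block n a b u"
  by (simp add: star_block_def)

lemma star_block_eq:
  assumes "v \<in> star_block n a b u"
  shows "star_block n a b v = star_block n a b u"
proof (cases "has_point_in_class a b (embo u)")
  case True
  then show ?thesis using assms by (simp add: star_block_def)
next
  case False
  then have s: "sim a b (embo u) (embo v)" using assms by (simp add: star_block_def)
  then have "\<not> has_point_in_class a b (embo v)" using False has_point_sim by blast
  then show ?thesis using False s by (auto simp: star_block_def intro: sim_trans sim_sym)
qed

text \<open>A class without points can always be followed across: from X through a line of
  \<open>a\<close> to the middle copy, then through a line of \<open>b\<close> to X', and likewise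
  backwards.\<close>

lemma star_block_gline:
  assumes a: "a \<in> PIstar n" and b: "b \<in> PIstar n" and u: "u \<in> carrier n"
    and np: "\<not> has_point_in_class a b (embo u)"
  shows "is_gline (star_block n a b u)"
proof (cases u)
  case (Inl x)
  obtain K where K: "K \<in> a" "u \<in> K" using PIstar_block_exists[OF a u] by blast
  have "\<not> is_point K" using has_pointI1[OF K(1) _ K(2), of b "embo u"] np Inl by auto
  then have "is_gline K" using PIstar_block_cases[OF a K(1)] by blast
  then obtain y where y: "Inr y \<in> K" by (auto simp: is_gline_def)
  have s1: "sim a b (embo u) (1, y)" using sim_emb1[OF K(1,2) y, of b] Inl by simp
  have "Inl y \<in> carrier n" using PIstar_block_subset[OF a K(1)] y by auto
  then obtain K' where K': "K' \<in> b" "Inl y \<in> K'" using PIstar_block_exists[OF b] by blast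
  have "\<not> is_point K'" using has_pointI2[OF K'(1) _ K'(2), of a "embo u"] np s1 by auto
  then have "is_gline K'" using PIstar_block_cases[OF b K'(1)] by blast
  then obtain w where w: "Inr w \<in> K'" by (auto simp: is_gline_def)
  have "sim a b (1, y) (2, w)" using sim_emb2[OF K'(1,2) w, of a] by simp
  then have "sim a b (embo u) (embo (Inr w))" using sim_trans[OF s1] by simp
  moreover have "Inr w \<in> carrier n" using PIstar_block_subset[OF b K'(1)] w by auto
  ultimately have "Inr w \<in> star_block n a b u" using np by (simp add: star_block_def)
  moreover have "Inl x \<in> star_block n a b u" using star_block_self[OF u] Inl by simp
  ultimately show ?thesis by (auto simp: is_gline_def)
next
  case (Inr x)
  obtain K where K: "K \<in> b" "u \<in> K" using PIstar_block_exists[OF b u] by blast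
  have "\<not> is_point K" using has_pointI2[OF K(1) _ K(2), of a "embo u"] np Inr by auto
  then have "is_gline K" using PIstar_block_cases[OF b K(1)] by blast
  then obtain y where y: "Inl y \<in> K" by (auto simp: is_gline_def)
  have s1: "sim a b (embo u) (1, y)" using sim_emb2[OF K(1,2) y, of a] Inr by simp
  have "Inr y \<in> carrier n" using PIstar_block_subset[OF b K(1)] y by auto
  then obtain K' where K': "K' \<in> a" "Inr y \<in> K'" using PIstar_block_exists[OF a] by blast
  have "\<not> is_point K'" using has_pointI1[OF K'(1) _ K'(2), of b "embo u"] np s1 by auto
  then have "is_gline K'" using PIstar_block_cases[OF a K'(1)] by blast
  then obtain w where w: "Inl w \<in> K'" by (auto simp: is_gline_def)
  have "sim a b (1, y) (0, w)" using sim_emb1[OF K'(1,2) w, of b] by simp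
  then have "sim a b (embo u) (embo (Inl w))" using sim_trans[OF s1] by simp
  moreover have "Inl w \<in> carrier n" using PIstar_block_subset[OF a K'(1)] w by auto
  ultimately have "Inl w \<in> star_block n a b u" using np by (simp add: star_block_def)
  moreover have "Inr x \<in> star_block n a b u" using star_block_self[OF u] Inr by simp
  ultimately show ?thesis by (auto simp: is_gline_def)
qed

lemma star_in_PIstar:
  assumes a: "a \<in> PIstar n" and b: "b \<in> PIstar n"
  shows "star n a b \<in> PIstar n"
  unfolding PIstar_def is_partition_def mem_Collect_eq
proof (intro conjI ballI impI)
  fix B assume "B \<in> star n a b"
  then obtain u where u: "u \<in> carrier n" "B = star_block n a b u" by (auto simp: star_eq)
  then show "B \<noteq> {}" using star_block_self by blast
  show "is_point B \<or> is_gline B"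
    using star_block_gline[OF a b u(1)] u(2) by (cases "has_point_in_class a b (embo u)")
      (auto simp: star_block_def is_point_def)
next
  fix B C assume BC: "B \<in> star n a b" "C \<in> star n a b" "B \<noteq> C"
  then obtain u v where uv: "B = star_block n a b u" "C = star_block n a b v"
    by (auto simp: star_eq)
  have "B = C" if "w \<in> B" "w \<in> C" for w
    using star_block_eq[of w n a b u] star_block_eq[of w n a b v] that uv by simp
  then show "B \<inter> C = {}" using BC(3) by blast
next
  have "star_block n a b u \<subseteq> carrier n" if "u \<in> carrier n" for u
    using that by (auto simp: star_block_def)
  then show "\<Union>(star n a b) = carrier n"
    unfolding star_eq using star_block_self[of _ n a b] by (intro equalityI UN_least subsetI) auto
qed

text \<open>A union of lines of the product saturates to a union of point-free
  \<open>sim\<close>-classes, and the trace of these on the middle copy is the intermediate set.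
  Conversely, sets A, B, C linked by \<open>a\<close> and \<open>b\<close> form a set closed under
  the generating relation that meets no point.\<close>

lemma line_rel_star:
  assumes a: "a \<in> PIstar n" and b: "b \<in> PIstar n"
  shows "line_rel (star n a b) = line_rel a O line_rel b"
proof (intro equalityI subrelI)
  fix A C assume "(A, C) \<in> line_rel (star n a b)"
  note AC = this[unfolded line_rel_iff[OF star_in_PIstar[OF a b]]]
  define U where "U = Inl ` A \<union> Inr ` C"
  have Uc: "U \<subseteq> carrier n" using AC by (auto simp: U_def)
  have np: "\<not> has_point_in_class a b (embo u)" if u: "u \<in> U" for u
  proof
    assume "has_point_in_class a b (embo u)"
    then have "{u} \<in> star n a b" using u Uc by (force simp: star_eq star_block_def)
    then have "is_gline {u}" using AC u unfolding U_def by blast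
    then show False using point_not_gline by (auto simp: is_point_def)
  qed
  have cl: "v \<in> U" if "u \<in> U" "v \<in> carrier n" "sim a b (embo u) (embo v)" for u v
  proof -
    have "star_block n a b u \<in> star n a b" using that Uc by (auto simp: star_eq)
    moreover have "u \<in> star_block n a b u" using star_block_self that Uc by blast
    moreover have "v \<in> star_block n a b u" using that np by (simp add: star_block_def)
    ultimately show ?thesis using AC that(1) unfolding U_def by blast
  qed
  \<comment> \<open>The saturation of \<open>U\<close> in the three copies; its trace
    \<open>B\<close> on the middle copy is the witness for the composition.\<close>
  define D where "D = {w. \<exists>u\<in>U. sim a b (embo u) w}"
  define B where "B = {x\<in>{1..n}. (1, x) \<in> D}"
  have Dsim: "w \<in> D" if "z \<in> D" "sim a b z w" for z w
    using that sim_trans unfolding D_def by blast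
  have D0: "(0, x) \<in> D \<longleftrightarrow> x \<in> A" if "x \<in> {1..n}" for x
  proof
    assume "(0, x) \<in> D"
    then obtain u where "u \<in> U" "sim a b (embo u) (embo (Inl x))" by (auto simp: D_def)
    then have "Inl x \<in> U" using cl that by simp
    then show "x \<in> A" by (auto simp: U_def)
  next
    assume "x \<in> A"
    then have "Inl x \<in> U" by (simp add: U_def)
    moreover have "sim a b (embo (Inl x)) (0, x)" by simp
    ultimately show "(0, x) \<in> D" unfolding D_def by blast
  qed
  have D2: "(2, x) \<in> D \<longleftrightarrow> x \<in> C" if "x \<in> {1..n}" for x
  proof
    assume "(2, x) \<in> D"
    then obtain u where "u \<in> U" "sim a b (embo u) (embo (Inr x))" by (auto simp: D_def)
    then have "Inr x \<in> U" using cl that by simp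
    then show "x \<in> C" by (auto simp: U_def)
  next
    assume "x \<in> C"
    then have "Inr x \<in> U" by (simp add: U_def)
    moreover have "sim a b (embo (Inr x)) (2, x)" by simp
    ultimately show "(2, x) \<in> D" unfolding D_def by blast
  qed
  have e1: "emb1 v \<in> D \<longleftrightarrow> v \<in> Inl ` A \<union> Inr ` B" if "v \<in> carrier n" for v
    using that D0 by (cases v) (auto simp: B_def)
  have e2: "emb2 v \<in> D \<longleftrightarrow> v \<in> Inl ` B \<union> Inr ` C" if "v \<in> carrier n" for v
    using that D2 by (cases v) (auto simp: B_def)
  have "(A, B) \<in> line_rel a"
    unfolding line_rel_iff[OF a]
  proof (intro conjI ballI)
    fix K assume K: "K \<in> a"
    show "K \<subseteq> Inl ` A \<union> Inr ` B \<and> is_gline K \<or> K \<inter> (Inl ` A \<union> Inr ` B) = {}"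
    proof (rule disjCI)
      assume "K \<inter> (Inl ` A \<union> Inr ` B) \<noteq> {}"
      then obtain v where v: "v \<in> K" "v \<in> Inl ` A \<union> Inr ` B" by blast
      have Kc: "K \<subseteq> carrier n" using PIstar_block_subset[OF a K] .
      have vD: "emb1 v \<in> D" using e1 v Kc by blast
      then have "K \<subseteq> Inl ` A \<union> Inr ` B" using e1 Dsim sim_emb1[OF K v(1)] Kc by blast
      moreover have "\<not> is_point K" using vD np has_pointI1[OF K _ v(1)] unfolding D_def by blast
      ultimately show "K \<subseteq> Inl ` A \<union> Inr ` B \<and> is_gline K" using PIstar_block_cases[OF a K] by blast
    qed
  qed (use AC in \<open>auto simp: B_def\<close>)
  moreover have "(B, C) \<in> line_rel b"
    unfolding line_rel_iff[OF b]
  proof (intro conjI ballI)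
    fix K assume K: "K \<in> b"
    show "K \<subseteq> Inl ` B \<union> Inr ` C \<and> is_gline K \<or> K \<inter> (Inl ` B \<union> Inr ` C) = {}"
    proof (rule disjCI)
      assume "K \<inter> (Inl ` B \<union> Inr ` C) \<noteq> {}"
      then obtain v where v: "v \<in> K" "v \<in> Inl ` B \<union> Inr ` C" by blast
      have Kc: "K \<subseteq> carrier n" using PIstar_block_subset[OF b K] .
      have vD: "emb2 v \<in> D" using e2 v Kc by blast
      then have "K \<subseteq> Inl ` B \<union> Inr ` C" using e2 Dsim sim_emb2[OF K v(1)] Kc by blast
      moreover have "\<not> is_point K" using vD np has_pointI2[OF K _ v(1)] unfolding D_def by blast
      ultimately show "K \<subseteq> Inl ` B \<union> Inr ` C \<and> is_gline K" using PIstar_block_cases[OF b K] by blast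
    qed
  qed (use AC in \<open>auto simp: B_def\<close>)
  ultimately show "(A, C) \<in> line_rel a O line_rel b" by blast
next
  fix A C assume "(A, C) \<in> line_rel a O line_rel b"
  then obtain B where "(A, B) \<in> line_rel a" "(B, C) \<in> line_rel b" by blast
  note AB = this(1)[unfolded line_rel_iff[OF a]] and BC = this(2)[unfolded line_rel_iff[OF b]]
  define D :: "(nat \<times> nat) set" where "D = {0} \<times> A \<union> {1} \<times> B \<union> {2} \<times> C"
  have e1: "emb1 v \<in> D \<longleftrightarrow> v \<in> Inl ` A \<union> Inr ` B" for v
    by (cases v) (auto simp: D_def)
  have e2: "emb2 v \<in> D \<longleftrightarrow> v \<in> Inl ` B \<union> Inr ` C" for v
    by (cases v) (auto simp: D_def)
  have eo: "embo v \<in> D \<longleftrightarrow> v \<in> Inl ` A \<union> Inr ` C" for v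
    by (cases v) (auto simp: D_def)
  have "w \<in> D" if zw: "gen_rel a b z w" "z \<in> D" for z w
  proof -
    consider K u v where "K \<in> a" "u \<in> K" "v \<in> K" "z = emb1 u" "w = emb1 v"
      | K u v where "K \<in> b" "u \<in> K" "v \<in> K" "z = emb2 u" "w = emb2 v"
      using zw(1) unfolding gen_rel_def by blast
    then show ?thesis
    proof cases
      case 1
      then have "u \<in> Inl ` A \<union> Inr ` B" using zw(2) e1 by blast
      then have "v \<in> Inl ` A \<union> Inr ` B" using AB 1(1-3) by blast
      then show ?thesis using 1(5) e1 by blast
    next
      case 2
      then have "u \<in> Inl ` B \<union> Inr ` C" using zw(2) e2 by blast
      then have "v \<in> Inl ` B \<union> Inr ` C" using BC 2(1-3) by blast
      then show ?thesis using 2(5) e2 by blast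
    qed
  qed
  then have cl: "w \<in> D" if "sim a b z w" "z \<in> D" for z w
    using sim_closed that by metis
  have np: "\<not> has_point_in_class a b z" if "z \<in> D" for z
  proof
    assume "has_point_in_class a b z"
    then consider u where "{u} \<in> a" "sim a b z (emb1 u)" | u where "{u} \<in> b" "sim a b z (emb2 u)"
      unfolding has_point_in_class_def is_point_def by auto
    then have "\<exists>u :: nat + nat. is_gline {u}"
    proof cases
      case 1
      then have "u \<in> Inl ` A \<union> Inr ` B" using cl[OF _ that] e1 by blast
      then show ?thesis using AB 1(1) by blast
    next
      case 2
      then have "u \<in> Inl ` B \<union> Inr ` C" using cl[OF _ that] e2 by blast
      then show ?thesis using BC 2(1) by blast
    qed
    then show False using point_not_gline by (auto simp: is_point_def)
  qed
  show "(A, C) \<in> line_rel (star n a b)"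
    unfolding line_rel_iff[OF star_in_PIstar[OF a b]]
  proof (intro conjI ballI)
    fix K assume "K \<in> star n a b"
    then obtain u where u: "u \<in> carrier n" "K = star_block n a b u" by (auto simp: star_eq)
    show "K \<subseteq> Inl ` A \<union> Inr ` C \<and> is_gline K \<or> K \<inter> (Inl ` A \<union> Inr ` C) = {}"
    proof (rule disjCI)
      assume "K \<inter> (Inl ` A \<union> Inr ` C) \<noteq> {}"
      then obtain v where v: "v \<in> K" "v \<in> Inl ` A \<union> Inr ` C" by blast
      have vc: "v \<in> carrier n" using v(2) AB BC by auto
      have K: "K = star_block n a b v" using star_block_eq u v by blast
      have nv: "\<not> has_point_in_class a b (embo v)" using np eo v(2) by blast
      have "w \<in> Inl ` A \<union> Inr ` C" if "w \<in> K" for w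
        using cl[of "embo v" "embo w"] eo v(2) that K nv unfolding star_block_def by simp
      then show "K \<subseteq> Inl ` A \<union> Inr ` C \<and> is_gline K"
        using star_block_gline[OF a b vc nv] K by blast
    qed
  qed (use AB BC in auto)
qed

text \<open>Labels name the classes of an element on both sides; the label shared by the two copies of \<open>0\<close> is
that of all points.  No member of a related pair contains \<open>0\<close>, so points belong to no such set.\<close>

definition lab_rel :: "nat \<Rightarrow> (nat \<Rightarrow> nat) \<Rightarrow> (nat \<Rightarrow> nat) \<Rightarrow> (nat set \<times> nat set) set" where
  "lab_rel n p q = {(A, B). A \<subseteq> {1..n} \<and> B \<subseteq> {1..n} \<and>
     (\<forall>x\<in>{0..n}. \<forall>y\<in>{0..n}. p x = q y \<longrightarrow> (x \<in> A \<longleftrightarrow> y \<in> B))}"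

text \<open>Equality of the images says that every label is used on both sides, so that each class
  other than that of 0 is a generalised line.\<close>

definition labelling :: "nat \<Rightarrow> (nat \<Rightarrow> nat) \<Rightarrow> (nat \<Rightarrow> nat) \<Rightarrow> bool" where
  "labelling n p q \<longleftrightarrow> p 0 = q 0 \<and> p ` {0..n} = q ` {0..n}"

definition PRel :: "nat \<Rightarrow> (nat set \<times> nat set) set set" where
  "PRel n = {lab_rel n p q | p q. labelling n p q}"

section \<open>Labellings yield exactly the relations of partitions\<close>

lemma lab_relD:
  assumes "(A, B) \<in> lab_rel n p q"
  shows "A \<subseteq> {1..n}" "B \<subseteq> {1..n}" "0 \<notin> A" "0 \<notin> B"
    "x \<le> n \<Longrightarrow> y \<le> n \<Longrightarrow> p x = q y \<Longrightarrow> x \<in> A \<longleftrightarrow> y \<in> B"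
  using assms by (auto simp: lab_rel_def)

lemma labelling_sym: "labelling n p q \<Longrightarrow> labelling n q p"
  by (simp add: labelling_def)

lemma labellingE1: "labelling n p q \<Longrightarrow> x \<le> n \<Longrightarrow> \<exists>y\<le>n. p x = q y"
  unfolding labelling_def by (force dest: equalityD1)

lemma labellingE2: "labelling n p q \<Longrightarrow> y \<le> n \<Longrightarrow> \<exists>x\<le>n. p x = q y"
  using labellingE1[OF labelling_sym, of n p q y] by metis

text \<open>The blocks are the label classes, except that the class of the label of 0 is broken into
  singletons. Every other class has elements on both sides because the two label images
  agree.\<close>

lemma PIstar_of_labelling:
  assumes l: "labelling n p q"
  shows "\<exists>a\<in>PIstar n. line_rel a = lab_rel n p q"
proof -
  define lab where "lab = case_sum p q"
  have lab: "lab (Inl x) = p x" "lab (Inr x) = q x" for x by (simp_all add: lab_def)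
  define blk where "blk u = (if lab u = p 0 then {u} else {v \<in> carrier n. lab v = lab u})" for u
  define a where "a = blk ` carrier n"
  have self: "u \<in> blk u" if "u \<in> carrier n" for u using that by (simp add: blk_def)
  have eq: "blk v = blk u" if "v \<in> blk u" for u v
    using that by (auto simp: blk_def split: if_splits)
  have sub: "blk u \<subseteq> carrier n" if "u \<in> carrier n" for u using that by (simp add: blk_def)
  have partner: "\<exists>v\<in>carrier n. lab v = lab u \<and> (v \<in> range Inl) \<noteq> (u \<in> range Inl)"
    if u: "u \<in> carrier n" "lab u \<noteq> p 0" for u
  proof (cases u)
    case (Inl x)
    then obtain y where y: "y \<le> n" "p x = q y" using labellingE1[OF l, of x] u by auto
    moreover have "y \<noteq> 0" using u y Inl l by (intro notI) (simp add: lab labelling_def)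
    ultimately show ?thesis using Inl by (intro bexI[of _ "Inr y"]) (auto simp: lab)
  next
    case (Inr y)
    then obtain x where x: "x \<le> n" "p x = q y" using labellingE2[OF l, of y] u by auto
    moreover have "x \<noteq> 0" using u x Inr by (intro notI) (simp add: lab)
    ultimately show ?thesis using Inr by (intro bexI[of _ "Inl x"]) (auto simp: lab)
  qed
  have gl: "is_gline (blk u)" if u: "u \<in> carrier n" "lab u \<noteq> p 0" for u
  proof -
    obtain v where v: "v \<in> carrier n" "lab v = lab u" "(v \<in> range Inl) \<noteq> (u \<in> range Inl)"
      using partner[OF u] by blast
    then have "v \<in> blk u" "u \<in> blk u" using u by (auto simp: blk_def)
    then show ?thesis using v(3) unfolding is_gline_def by (cases u; cases v) auto
  qed
  have aP: "a \<in> PIstar n"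
    unfolding PIstar_def is_partition_def mem_Collect_eq
  proof (intro conjI ballI impI)
    fix B assume "B \<in> a"
    then obtain u where u: "u \<in> carrier n" "B = blk u" by (auto simp: a_def)
    then show "B \<noteq> {}" using self by blast
    show "is_point B \<or> is_gline B"
      using gl[OF u(1)] u(2) by (cases "lab u = p 0") (auto simp: is_point_def blk_def)
  next
    fix B C assume BC: "B \<in> a" "C \<in> a" "B \<noteq> C"
    then obtain u v where uv: "B = blk u" "C = blk v" by (auto simp: a_def)
    have "B = C" if "w \<in> B" "w \<in> C" for w
      using eq[of w u] eq[of w v] that uv by simp
    then show "B \<inter> C = {}" using BC(3) by blast
  next
    show "\<Union>a = carrier n"
      unfolding a_def using self sub by (intro equalityI UN_least subsetI) auto
  qed
  have "line_rel a = lab_rel n p q"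
  proof (intro equalityI subrelI)
    fix A B assume "(A, B) \<in> line_rel a"
    note AB = this[unfolded line_rel_iff[OF aP]]
    have zero: "u \<notin> Inl ` A \<union> Inr ` B" if u: "u \<in> carrier n" "lab u = p 0" for u
    proof -
      have "{u} \<in> a" using u by (force simp: a_def blk_def)
      moreover have "\<not> is_gline {u}" using point_not_gline by (auto simp: is_point_def)
      ultimately show ?thesis using AB by blast
    qed
    have "x \<in> A \<longleftrightarrow> y \<in> B" if xy: "x \<le> n" "y \<le> n" "p x = q y" for x y
    proof (cases "p x = p 0")
      case True
      have "x \<notin> A" using zero[of "Inl x"] True AB by (auto simp: lab)
      moreover have "y \<notin> B" using zero[of "Inr y"] True xy AB by (auto simp: lab)
      ultimately show ?thesis by blast
    next
      case False
      then have nz: "x \<noteq> 0" "y \<noteq> 0" using xy l by (auto simp: labelling_def intro: gr0I)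
      then have "Inl x \<in> carrier n" "Inr y \<in> carrier n" using xy by auto
      then have "blk (Inl x) \<in> a" "Inl x \<in> blk (Inl x)" using self by (simp_all only: a_def imageI)
      moreover have "Inr y \<in> blk (Inl x)"
        using \<open>Inr y \<in> carrier n\<close> xy(3) False by (simp add: blk_def lab)
      ultimately show ?thesis using AB by blast
    qed
    then show "(A, B) \<in> lab_rel n p q" using AB by (auto simp: lab_rel_def)
  next
    fix A B assume AB: "(A, B) \<in> lab_rel n p q"
    note D = lab_relD[OF AB]
    have zero: "u \<notin> Inl ` A \<union> Inr ` B" if u: "u \<in> carrier n" "lab u = p 0" for u
      using D(3,4) D(5)[of 0] D(5)[of _ 0] l u
      by (cases u) (auto simp: lab labelling_def)
    have opp: "u \<in> Inl ` A \<union> Inr ` B \<longleftrightarrow> v \<in> Inl ` A \<union> Inr ` B"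
      if uv: "u \<in> carrier n" "v \<in> carrier n" "lab u = lab v" "(v \<in> range Inl) \<noteq> (u \<in> range Inl)" for u v
    proof (cases u)
      case (Inl x)
      then obtain y where y: "v = Inr y" using uv(4) by (cases v) auto
      then have "x \<in> A \<longleftrightarrow> y \<in> B" using Inl uv(1-3) by (intro D(5)) (simp_all add: lab)
      then show ?thesis using Inl y by auto
    next
      case (Inr y)
      then obtain x where x: "v = Inl x" using uv(4) by (cases v) auto
      then have "x \<in> A \<longleftrightarrow> y \<in> B" using Inr uv(1-3) by (intro D(5)) (simp_all add: lab)
      then show ?thesis using Inr x by auto
    qed
    \<comment> \<open>\<open>lab_rel\<close> compares opposite sides only, so two elements on one
      side are compared through a partner on the other.\<close>
    have same: "v \<in> Inl ` A \<union> Inr ` B"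
      if uv: "u \<in> carrier n" "v \<in> carrier n" "lab u = lab v" "u \<in> Inl ` A \<union> Inr ` B" for u v
    proof (cases "(v \<in> range Inl) = (u \<in> range Inl)")
      case True
      have nz: "lab u \<noteq> p 0" using zero uv by blast
      then obtain w where w: "w \<in> carrier n" "lab w = lab u" "(w \<in> range Inl) \<noteq> (u \<in> range Inl)"
        using partner[OF uv(1) nz] by (elim bexE conjE)
      have "w \<in> Inl ` A \<union> Inr ` B" using iffD1[OF opp[OF uv(1) w(1) w(2)[symmetric] w(3)] uv(4)] .
      moreover have "lab w = lab v" "(v \<in> range Inl) \<noteq> (w \<in> range Inl)" using uv(3) w True by simp_all
      ultimately show ?thesis using iffD1[OF opp[OF w(1) uv(2)]] by simp
    next
      case False
      then show ?thesis using iffD1[OF opp[OF uv(1-3)] uv(4)] by simp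
    qed
    show "(A, B) \<in> line_rel a"
      unfolding line_rel_iff[OF aP]
    proof (intro conjI ballI)
      fix K assume "K \<in> a"
      then obtain u where u: "u \<in> carrier n" "K = blk u" by (auto simp: a_def)
      show "K \<subseteq> Inl ` A \<union> Inr ` B \<and> is_gline K \<or> K \<inter> (Inl ` A \<union> Inr ` B) = {}"
      proof (rule disjCI)
        assume "K \<inter> (Inl ` A \<union> Inr ` B) \<noteq> {}"
        then obtain v where v: "v \<in> K" "v \<in> Inl ` A \<union> Inr ` B" by blast
        have vc: "v \<in> carrier n" using v u sub by blast
        have K: "K = blk v" using eq u v by blast
        have nz: "lab v \<noteq> p 0" using zero v vc by blast
        have "w \<in> Inl ` A \<union> Inr ` B" if "w \<in> K" for w
          using same[OF vc _ _ v(2), of w] that K nz by (simp add: blk_def)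
        then show "K \<subseteq> Inl ` A \<union> Inr ` B \<and> is_gline K" using gl[OF vc nz] K by blast
      qed
    qed (use D in auto)
  qed
  then show ?thesis using aP by (intro bexI)
qed

text \<open>An injection \<open>f\<close> numbers the lines. The successor keeps label 0 free for
  everything outside the lines, in particular for 0 itself on both sides.\<close>

lemma labelling_of_PIstar:
  assumes a: "a \<in> PIstar n"
  shows "\<exists>p q. labelling n p q \<and> line_rel a = lab_rel n p q"
proof -
  have "finite (lines a)" using finite_PIstar_elem[OF a] by (simp add: lines_def)
  then obtain f :: "(nat + nat) set \<Rightarrow> nat" where f: "inj_on f (lines a)"
    using finite_imp_inj_to_nat_seg by blast
  define lab where "lab u = (if \<exists>K\<in>lines a. u \<in> K then Suc (f (THE K. K \<in> lines a \<and> u \<in> K)) else 0)" for u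
  have disj: "K = K'" if "K \<in> lines a" "K' \<in> lines a" "u \<in> K" "u \<in> K'" for K K' u
    using that PIstar_disjoint[OF a] by (auto simp: lines_def)
  have labK: "lab u = Suc (f K)" if "K \<in> lines a" "u \<in> K" for u K
  proof -
    have "(THE K. K \<in> lines a \<and> u \<in> K) = K" using that disj by (intro the_equality) auto
    then show ?thesis using that by (auto simp: lab_def)
  qed
  have lab0: "lab u = 0" if "u \<notin> \<Union>(lines a)" for u using that by (auto simp: lab_def)
  have labI: "v \<in> K" if "lab u = lab v" "K \<in> lines a" "u \<in> K" for u v K
  proof -
    have u: "lab u = Suc (f K)" using labK that by blast
    have "v \<in> \<Union>(lines a)" using lab0[of v] u that(1) by fastforce
    then obtain K' where K': "K' \<in> lines a" "v \<in> K'" by blast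
    then have "f K' = f K" using labK u that(1) by simp
    then show ?thesis using f K' that(2) by (auto dest: inj_onD)
  qed
  have sub: "K \<subseteq> carrier n" if "K \<in> lines a" for K
    using that PIstar_block_subset[OF a] by (auto simp: lines_def)
  have c0: "Inl 0 \<notin> \<Union>(lines a)" "Inr 0 \<notin> \<Union>(lines a)" using sub by fastforce+
  have glD: "\<exists>x. Inl x \<in> K" "\<exists>x. Inr x \<in> K" if "K \<in> lines a" for K
    using that by (auto simp: lines_def is_gline_def)
  define p where "p x = lab (Inl x)" for x
  define q where "q x = lab (Inr x)" for x
  have im: "lab ` g ` {0..n} = insert 0 ((\<lambda>K. Suc (f K)) ` lines a)"
    if g0: "g 0 \<notin> \<Union>(lines a)" and gK: "\<And>K. K \<in> lines a \<Longrightarrow> \<exists>x\<in>{0..n}. g x \<in> K"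
    for g :: "nat \<Rightarrow> nat + nat"
  proof
    have "lab u \<in> insert 0 ((\<lambda>K. Suc (f K)) ` lines a)" for u
      using labK lab0 by (cases "u \<in> \<Union>(lines a)") fastforce+
    then show "lab ` g ` {0..n} \<subseteq> insert 0 ((\<lambda>K. Suc (f K)) ` lines a)" by (intro image_subsetI)
    have "0 \<in> lab ` g ` {0..n}" using lab0[OF g0] by (intro image_eqI[of _ _ "g 0"]) auto
    moreover have "Suc (f K) \<in> lab ` g ` {0..n}" if K: "K \<in> lines a" for K
    proof -
      obtain x where "x \<in> {0..n}" "g x \<in> K" using gK[OF K] by blast
      then show ?thesis using labK[OF K, of "g x"] by (intro image_eqI[of _ _ "g x"]) auto
    qed
    ultimately show "insert 0 ((\<lambda>K. Suc (f K)) ` lines a) \<subseteq> lab ` g ` {0..n}" by blast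
  qed
  have exl: "\<exists>x\<in>{0..n}. Inl x \<in> K" "\<exists>x\<in>{0..n}. Inr x \<in> K" if K: "K \<in> lines a" for K
  proof -
    have "x \<in> {0..n}" if "Inl x \<in> K \<or> Inr x \<in> K" for x
      using that sub[OF K] carrier_iff[of x n] by auto
    then show "\<exists>x\<in>{0..n}. Inl x \<in> K" "\<exists>x\<in>{0..n}. Inr x \<in> K" using glD[OF K] by blast+
  qed
  have "p ` {0..n} = q ` {0..n}"
    using im[of Inl, OF c0(1) exl(1)] im[of Inr, OF c0(2) exl(2)]
    unfolding p_def q_def image_image by simp
  then have l: "labelling n p q" using c0 lab0 by (simp add: labelling_def p_def q_def)
  have "line_rel a = lab_rel n p q"
  proof (intro equalityI subrelI)
    fix A B assume AB: "(A, B) \<in> line_rel a"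
    then obtain F where F: "F \<subseteq> lines a" "A = Inl -` \<Union>F" "B = Inr -` \<Union>F"
      by (auto simp: line_rel_def)
    have same: "u \<in> \<Union>F \<longleftrightarrow> v \<in> \<Union>F" if "lab u = lab v" for u v
      using labI[OF that] labI[OF that[symmetric]] F(1) by blast
    have "x \<in> A \<longleftrightarrow> y \<in> B" if "p x = q y" for x y
      using same[OF that[unfolded p_def q_def]] unfolding F(2,3) vimage_eq .
    moreover have "A \<subseteq> {1..n} \<and> B \<subseteq> {1..n}"
      using AB unfolding line_rel_iff[OF a] by (elim conjE) (intro conjI)
    ultimately show "(A, B) \<in> lab_rel n p q" by (simp add: lab_rel_def)
  next
    fix A B assume AB: "(A, B) \<in> lab_rel n p q"
    note D = lab_relD[OF AB]
    show "(A, B) \<in> line_rel a"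
      unfolding line_rel_iff[OF a]
    proof (intro conjI ballI)
      fix K assume K: "K \<in> a"
      show "K \<subseteq> Inl ` A \<union> Inr ` B \<and> is_gline K \<or> K \<inter> (Inl ` A \<union> Inr ` B) = {}"
      proof (rule disjCI)
        assume "K \<inter> (Inl ` A \<union> Inr ` B) \<noteq> {}"
        then obtain v where v: "v \<in> K" "v \<in> Inl ` A \<union> Inr ` B" by blast
        have Kl: "K \<in> lines a"
        proof (rule ccontr)
          assume "K \<notin> lines a"
          then have "v \<notin> \<Union>(lines a)"
            using PIstar_disjoint[OF a K _ v(1)] by (auto simp: lines_def)
          then have "lab v = lab (Inl 0)" "lab v = lab (Inr 0)" using lab0 c0 by simp_all
          then show False using v(2) D(1-4) D(5)[of 0] D(5)[of _ 0]
            by (auto simp: p_def q_def)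
        qed
        then obtain x y where xy: "x \<in> {0..n}" "Inl x \<in> K" "y \<in> {0..n}" "Inr y \<in> K"
          using exl by metis
        have Lx: "x' \<in> A \<longleftrightarrow> y' \<in> B" if "Inl x' \<in> K" "Inr y' \<in> K" for x' y'
        proof -
          have "p x' = q y'" using labK[OF Kl that(1)] labK[OF Kl that(2)] by (simp add: p_def q_def)
          moreover have "x' \<le> n" "y' \<le> n" using sub[OF Kl] that by fastforce+
          ultimately show ?thesis using D(5) by blast
        qed
        have "x \<in> A" "y \<in> B" using Lx xy v by blast+
        have "w \<in> Inl ` A \<union> Inr ` B" if "w \<in> K" for w
          using that Lx xy \<open>x \<in> A\<close> \<open>y \<in> B\<close> by (cases w) auto
        then show "K \<subseteq> Inl ` A \<union> Inr ` B \<and> is_gline K" using Kl by (auto simp: lines_def)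
      qed
    qed (use D in auto)
  qed
  then show ?thesis using l by (intro exI conjI)
qed

lemma PRel_eq: "PRel n = line_rel ` PIstar n"
proof (intro equalityI subsetI)
  fix R assume "R \<in> PRel n"
  then obtain p q where "labelling n p q" "R = lab_rel n p q" by (auto simp: PRel_def)
  then show "R \<in> line_rel ` PIstar n" using PIstar_of_labelling[of n p q] by force
next
  fix R assume "R \<in> line_rel ` PIstar n"
  then show "R \<in> PRel n" 
    using labelling_of_PIstar[of _ n] by (auto simp: PRel_def) blast
qed

lemma PRel_comp: "R \<in> PRel n \<Longrightarrow> S \<in> PRel n \<Longrightarrow> R O S \<in> PRel n"
  unfolding PRel_eq using line_rel_star[symmetric] star_in_PIstar by auto

section \<open>Splitting and swapping classes of idempotents\<close>

text \<open>The partition encoded by \<open>D\<close>. As 0 lies in no member of a ring, its class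
  consists of the elements outside the union of the ring.\<close>

definition indist :: "nat set set \<Rightarrow> nat \<Rightarrow> nat \<Rightarrow> bool" where
  "indist D x y \<longleftrightarrow> (\<forall>A\<in>D. x \<in> A \<longleftrightarrow> y \<in> A)"

text \<open>A fixed-point condition: \<open>D\<close> consists of all unions of those classes of its
  own partition of {0..n} that do not contain 0. Rings thus correspond to such partitions, larger
  rings to finer ones.\<close>

definition set_ring :: "nat \<Rightarrow> nat set set \<Rightarrow> bool" where
  "set_ring n D \<longleftrightarrow>
     D = {A. A \<subseteq> {1..n} \<and> (\<forall>x\<le>n. \<forall>y\<le>n. indist D x y \<longrightarrow> (x \<in> A \<longleftrightarrow> y \<in> A))}"

lemma indistD: "indist D x y \<Longrightarrow> A \<in> D \<Longrightarrow> x \<in> A \<longleftrightarrow> y \<in> A"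
  by (simp add: indist_def)

lemma indist_refl [simp]: "indist D x x"
  by (simp add: indist_def)

lemma indist_sym: "indist D x y \<Longrightarrow> indist D y x"
  by (simp add: indist_def)

lemma indist_trans: "indist D x y \<Longrightarrow> indist D y z \<Longrightarrow> indist D x z"
  by (simp add: indist_def)

lemma indist_mono: "indist D x y \<Longrightarrow> E \<subseteq> D \<Longrightarrow> indist E x y"
  unfolding indist_def by blast

text \<open>The least element of a class serves as its label.\<close>

lemma indist_labels:
  obtains p :: "nat \<Rightarrow> nat" where "\<And>x y. p x = p y \<longleftrightarrow> indist D x y"
proof
  show "(LEAST z. indist D x z) = (LEAST z. indist D y z) \<longleftrightarrow> indist D x y"
    (is "?p x = ?p y \<longleftrightarrow> _") for x y
  proof
    have "indist D z (?p z)" for z by (rule LeastI[of _ z]) simp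
    then show "?p x = ?p y \<Longrightarrow> indist D x y" by (metis indist_sym indist_trans)
    assume "indist D x y"
    then have "indist D x = indist D y" by (intro ext) (metis indist_sym indist_trans)
    then show "?p x = ?p y" by simp
  qed
qed

lemma set_ring_subset: "set_ring n D \<Longrightarrow> A \<in> D \<Longrightarrow> A \<subseteq> {1..n}"
  unfolding set_ring_def by blast

lemma set_ring_zero: "set_ring n D \<Longrightarrow> A \<in> D \<Longrightarrow> 0 \<notin> A"
  using set_ring_subset by fastforce

lemma set_ring_memI:
  assumes "set_ring n D" "A \<subseteq> {1..n}"
    "\<And>x y. x \<le> n \<Longrightarrow> y \<le> n \<Longrightarrow> indist D x y \<Longrightarrow> x \<in> A \<Longrightarrow> y \<in> A"
  shows "A \<in> D"
proof -
  have "\<forall>x\<le>n. \<forall>y\<le>n. indist D x y \<longrightarrow> (x \<in> A \<longleftrightarrow> y \<in> A)"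
    using assms(3) indist_sym by blast
  then show ?thesis using assms(1,2) unfolding set_ring_def by blast
qed

lemma set_ringI:
  assumes "\<And>A. A \<in> D \<Longrightarrow> A \<subseteq> {1..n}"
    "\<And>A. A \<subseteq> {1..n} \<Longrightarrow> (\<And>x y. x \<le> n \<Longrightarrow> y \<le> n \<Longrightarrow> indist D x y \<Longrightarrow> x \<in> A \<Longrightarrow> y \<in> A) \<Longrightarrow> A \<in> D"
  shows "set_ring n D"
  unfolding set_ring_def
proof (intro equalityI subsetI)
  fix A assume "A \<in> D"
  then show "A \<in> {A. A \<subseteq> {1..n} \<and> (\<forall>x\<le>n. \<forall>y\<le>n. indist D x y \<longrightarrow> (x \<in> A \<longleftrightarrow> y \<in> A))}"
    using assms(1) by (auto dest: indistD)
qed (use assms(2) in blast)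

text \<open>Constrained elements are indistinguishable by construction, so a saturated set obeys
  every constraint. This is how all concrete rings below are recognised.\<close>

lemma set_ring_Collect:
  assumes "\<And>x y. P x y \<Longrightarrow> x \<le> n \<and> y \<le> n"
  shows "set_ring n {A. A \<subseteq> {1..n} \<and> (\<forall>x y. P x y \<longrightarrow> (x \<in> A \<longleftrightarrow> y \<in> A))}"
    (is "set_ring n ?D")
proof (rule set_ringI)
  fix A assume A: "A \<subseteq> {1..n}" "\<And>x y. x \<le> n \<Longrightarrow> y \<le> n \<Longrightarrow> indist ?D x y \<Longrightarrow> x \<in> A \<Longrightarrow> y \<in> A"
  have "x \<in> A \<longleftrightarrow> y \<in> A" if "P x y" for x y
  proof -
    have "indist ?D x y" "indist ?D y x" using that by (auto simp: indist_def)
    then show ?thesis using A(2) assms[OF that] by blast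
  qed
  then show "A \<in> ?D" using A(1) by blast
qed blast

lemma set_ring_Int:
  assumes "set_ring n D" "set_ring n E"
  shows "set_ring n (D \<inter> E)"
proof (rule set_ringI)
  fix A assume A: "A \<subseteq> {1..n}" "\<And>x y. x \<le> n \<Longrightarrow> y \<le> n \<Longrightarrow> indist (D \<inter> E) x y \<Longrightarrow> x \<in> A \<Longrightarrow> y \<in> A"
  have "indist (D \<inter> E) x y" if "indist D x y \<or> indist E x y" for x y
    using that unfolding indist_def by blast
  then have "A \<in> D" "A \<in> E"
    using A(2) by (intro set_ring_memI[OF assms(1) A(1)] set_ring_memI[OF assms(2) A(1)]; blast)+
  then show "A \<in> D \<inter> E" by blast
qed (use assms set_ring_subset in blast)

lemma set_ring_Pow:
  assumes "Y \<subseteq> {1..n}"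
  shows "set_ring n (Pow Y)"
proof (rule set_ringI)
  fix A assume A: "A \<subseteq> {1..n}" "\<And>x y. x \<le> n \<Longrightarrow> y \<le> n \<Longrightarrow> indist (Pow Y) x y \<Longrightarrow> x \<in> A \<Longrightarrow> y \<in> A"
  have "x \<in> Y" if "x \<in> A" for x
  proof (rule ccontr)
    assume "x \<notin> Y"
    then have "indist (Pow Y) x 0" using assms by (auto simp: indist_def)
    then have "0 \<in> A" using A that by fastforce
    then show False using A(1) by fastforce
  qed
  then show "A \<in> Pow Y" by blast
qed (use assms in blast)

lemma set_ring_Union: "set_ring n D \<Longrightarrow> \<Union>D \<in> D"
  by (rule set_ring_memI, assumption, use set_ring_subset in blast) (auto dest: indistD)

lemma set_ring_empty: "set_ring n D \<Longrightarrow> {} \<in> D"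
  by (rule set_ring_memI) auto

lemma set_ring_Union_subset: "set_ring n D \<Longrightarrow> \<Union>D \<subseteq> {1..n}"
  using set_ring_subset by blast

lemma indist_zero_iff: "set_ring n D \<Longrightarrow> indist D x 0 \<longleftrightarrow> x \<notin> \<Union>D"
  by (auto simp: indist_def set_ring_zero)

lemma finite_set_ring: "set_ring n D \<Longrightarrow> finite D"
  by (rule finite_subset[of _ "Pow {1..n}"]) (use set_ring_subset in blast, simp)

lemma subset_from_one:
  fixes B :: "nat set"
  assumes "B \<subseteq> {0..n}" "0 \<notin> B"
  shows "B \<subseteq> {1..n}"
proof
  fix y assume "y \<in> B"
  then have "y \<noteq> 0" "y \<le> n" using assms by (metis, auto)
  then show "y \<in> {1..n}" by simp
qed

lemma converse_lab_rel: "(lab_rel n p q)\<inverse> = lab_rel n q p"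
  unfolding lab_rel_def by (auto simp: set_eq_iff)

lemma lab_rel_saturated:
  assumes l: "labelling n p q" and AB: "(A, B) \<in> lab_rel n p q"
    and "x \<le> n" "y \<le> n" "p x = p y"
  shows "x \<in> A \<longleftrightarrow> y \<in> A"
  using labellingE1[OF l assms(3)] lab_relD(5)[OF AB] assms by metis

text \<open>The partner of a saturated set is forced: it collects the right-hand elements that share
  a label with it. It avoids 0 because the two copies of 0 have the same label.\<close>

lemma Domain_lab_rel:
  assumes l: "labelling n p q"
  shows "Domain (lab_rel n p q) =
    {A. A \<subseteq> {1..n} \<and> (\<forall>x y. x \<le> n \<and> y \<le> n \<and> p x = p y \<longrightarrow> (x \<in> A \<longleftrightarrow> y \<in> A))}"
proof (intro equalityI subsetI)
  fix A assume "A \<in> Domain (lab_rel n p q)"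
  then show "A \<in> {A. A \<subseteq> {1..n} \<and> (\<forall>x y. x \<le> n \<and> y \<le> n \<and> p x = p y \<longrightarrow> (x \<in> A \<longleftrightarrow> y \<in> A))}"
    using lab_rel_saturated[OF l] lab_relD(1) by blast
next
  fix A
  assume "A \<in> {A. A \<subseteq> {1..n} \<and> (\<forall>x y. x \<le> n \<and> y \<le> n \<and> p x = p y \<longrightarrow> (x \<in> A \<longleftrightarrow> y \<in> A))}"
  then have A: "A \<subseteq> {1..n}" "\<And>x y. x \<le> n \<Longrightarrow> y \<le> n \<Longrightarrow> p x = p y \<Longrightarrow> x \<in> A \<longleftrightarrow> y \<in> A" by blast+
  define B where "B = {y. y \<le> n \<and> (\<exists>x\<in>A. p x = q y)}"
  have An: "x \<le> n" if "x \<in> A" for x using A(1) that by auto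
  have "0 \<notin> B"
  proof
    assume "0 \<in> B"
    then obtain x where "x \<in> A" "p x = p 0" using l by (auto simp: B_def labelling_def)
    then have "0 \<in> A" using A(2)[of x 0] An[of x] by simp
    then show False using A(1) by auto
  qed
  moreover have "B \<subseteq> {0..n}" by (auto simp: B_def)
  ultimately have "B \<subseteq> {1..n}" by (rule subset_from_one[rotated])
  moreover have "x \<in> A \<longleftrightarrow> y \<in> B" if "x \<le> n" "y \<le> n" "p x = q y" for x y
  proof
    show "x \<in> A \<Longrightarrow> y \<in> B" using that(2,3) by (auto simp: B_def)
    assume "y \<in> B"
    then obtain x' where "x' \<in> A" "p x' = q y" by (auto simp: B_def)
    then show "x \<in> A" using A(2)[of x x'] An[of x'] that by simp
  qed
  ultimately show "A \<in> Domain (lab_rel n p q)" using A(1) by (auto simp: lab_rel_def)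
qed

text \<open>Every right label also occurs on the left, so membership in \<open>B\<close> can be read
  off from \<open>A\<close>. This gives functionality and, through the converse,
  injectivity.\<close>

lemma lab_rel_single_valued:
  assumes "labelling n p q" "(A, B) \<in> lab_rel n p q" "(A', B') \<in> lab_rel n p q" "A \<subseteq> A'"
  shows "B \<subseteq> B'"
proof
  fix y assume y: "y \<in> B"
  then have "y \<le> n" using lab_relD(2)[OF assms(2)] by auto
  then show "y \<in> B'"
    using labellingE2[OF assms(1)] lab_relD(5)[OF assms(2)] lab_relD(5)[OF assms(3)] y assms(4)
    by blast
qed

lemma PRelE:
  assumes "R \<in> PRel n"
  obtains p q where "labelling n p q" "R = lab_rel n p q"
  using assms by (auto simp: PRel_def)

lemma lab_rel_PRel: "labelling n p q \<Longrightarrow> lab_rel n p q \<in> PRel n"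
  by (auto simp: PRel_def)

lemma PRel_converse: "R \<in> PRel n \<Longrightarrow> R\<inverse> \<in> PRel n"
  by (metis PRelE converse_lab_rel labelling_sym lab_rel_PRel)

lemma PRel_mono: "R \<in> PRel n \<Longrightarrow> (A, B) \<in> R \<Longrightarrow> (A', B') \<in> R \<Longrightarrow> A \<subseteq> A' \<Longrightarrow> B \<subseteq> B'"
  by (metis PRelE lab_rel_single_valued)

lemma PRel_functional: "R \<in> PRel n \<Longrightarrow> (A, B) \<in> R \<Longrightarrow> (A, B') \<in> R \<Longrightarrow> B = B'"
  using PRel_mono[of R n A B A B'] PRel_mono[of R n A B' A B] by blast

lemma PRel_injective: "R \<in> PRel n \<Longrightarrow> (A, B) \<in> R \<Longrightarrow> (A', B) \<in> R \<Longrightarrow> A = A'"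
  using PRel_functional[OF PRel_converse] by blast

lemma set_ring_Domain:
  assumes "R \<in> PRel n"
  shows "set_ring n (Domain R)"
proof -
  obtain p q where pq: "labelling n p q" "R = lab_rel n p q" using PRelE[OF assms] .
  show ?thesis
    unfolding pq(2) Domain_lab_rel[OF pq(1)] by (rule set_ring_Collect) simp
qed

lemma set_ring_Range: "R \<in> PRel n \<Longrightarrow> set_ring n (Range R)"
  using set_ring_Domain[OF PRel_converse] by simp

text \<open>Monotonicity sends the largest set of the domain to the largest set of the
  range.\<close>

lemma PRel_Union:
  assumes R: "R \<in> PRel n"
  shows "(\<Union>(Domain R), \<Union>(Range R)) \<in> R"
proof -
  obtain B where B: "(\<Union>(Domain R), B) \<in> R"
    using set_ring_Union[OF set_ring_Domain[OF R]] by blast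
  have "B' \<subseteq> B" if "B' \<in> Range R" for B'
    using that PRel_mono[OF R _ B] by blast
  then have "\<Union>(Range R) = B" using B by blast
  then show ?thesis using B by simp
qed

lemma lab_rel_refl:
  assumes D: "set_ring n D" and p: "\<And>x y. p x = p y \<longleftrightarrow> indist D x y"
  shows "lab_rel n p p = Id_on D"
proof (intro equalityI subrelI)
  fix A B assume AB: "(A, B) \<in> lab_rel n p p"
  have "x \<in> A \<longleftrightarrow> x \<in> B" for x
    using lab_relD(5)[OF AB, of x x] lab_relD(1,2)[OF AB] by fastforce
  then have "A = B" by blast
  moreover have "A \<in> D"
  proof (rule set_ring_memI[OF D lab_relD(1)[OF AB]])
    fix x y assume "x \<le> n" "y \<le> n" "indist D x y" "x \<in> A"
    then show "y \<in> A"
      using lab_rel_saturated[OF _ AB, of x y] p by (simp add: labelling_def)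
  qed
  ultimately show "(A, B) \<in> Id_on D" by blast
next
  fix A B assume "(A, B) \<in> Id_on D"
  then show "(A, B) \<in> lab_rel n p p"
    using set_ring_subset[OF D] by (auto simp: lab_rel_def p dest: indistD)
qed

lemma Id_on_PRel:
  assumes "set_ring n D"
  shows "Id_on D \<in> PRel n"
proof -
  obtain p :: "nat \<Rightarrow> nat" where "\<And>x y. p x = p y \<longleftrightarrow> indist D x y"
    using indist_labels by blast
  then show ?thesis
    using lab_rel_refl[OF assms] lab_rel_PRel[of n p p] by (simp add: labelling_def)
qed

lemma finite_PRel: "finite (PRel n)"
proof (rule finite_subset)
  show "PRel n \<subseteq> Pow (Pow {1..n} \<times> Pow {1..n})"
    by (auto simp: PRel_def lab_rel_def)
qed simp

lemma PRel_relpow: "R \<in> PRel n \<Longrightarrow> k \<ge> 1 \<Longrightarrow> R ^^ k \<in> PRel n"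
proof (induction k)
  case (Suc k)
  then show ?case using PRel_comp by (cases "k = 0") auto
qed simp

text \<open>If (A, B) factors through C, functionality gives C = B and injectivity then gives A =
  C.\<close>

lemma PRel_idempotent:
  assumes S: "S \<in> PRel n" and SS: "S O S = S"
  shows "S = Id_on (Domain S)"
proof -
  have "A = B" if "(A, B) \<in> S" for A B
  proof -
    obtain C where "(A, C) \<in> S" "(C, B) \<in> S" using \<open>(A, B) \<in> S\<close> SS by blast
    then show ?thesis using PRel_functional[OF S] PRel_injective[OF S] that by metis
  qed
  then show ?thesis by fastforce
qed

lemma PRel_comp_converse:
  assumes R: "R \<in> PRel n"
  shows "R O R\<inverse> = Id_on (Domain R)"
proof (intro equalityI subrelI)
  fix A A' assume "(A, A') \<in> R O R\<inverse>"
  then obtain B where "(A, B) \<in> R" "(A', B) \<in> R" by blast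
  then show "(A, A') \<in> Id_on (Domain R)" using PRel_injective[OF R] by blast
qed blast

lemma relpow_subset:
  fixes R :: "('a \<times> 'a) set"
  assumes "k \<ge> 1"
  shows "Domain (R ^^ k) \<subseteq> Domain R" "Range (R ^^ k) \<subseteq> Range R"
proof -
  obtain j where k: "k = Suc j" using assms by (cases k) auto
  have *: "R ^^ k = R O R ^^ j" "R ^^ k = R ^^ j O R" using relpow_commute[of R j] k by simp_all
  show "Domain (R ^^ k) \<subseteq> Domain R" by (subst *(1)) blast
  show "Range (R ^^ k) \<subseteq> Range R" by (subst *(2)) blast
qed

lemma ex_idempotent_relpow:
  assumes R: "R \<in> PRel n"
  obtains k D where "k \<ge> 1" "R ^^ k = Id_on D" "set_ring n D" "D \<subseteq> Domain R" "D \<subseteq> Range R"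
proof -
  have "finite ((\<lambda>k. R ^^ k) ` {1..})"
    by (rule finite_subset[OF _ finite_PRel[of n]]) (use PRel_relpow[OF R] in auto)
  then have "\<not> inj_on (\<lambda>k. R ^^ k) {1..}"
    using finite_imageD infinite_Ici by blast
  then obtain i0 j0 where ij0: "i0 \<ge> 1" "j0 \<ge> 1" "i0 \<noteq> j0" "R ^^ i0 = R ^^ j0"
    unfolding inj_on_def by auto
  define i where "i = min i0 j0"
  define d where "d = max i0 j0 - i"
  have i: "i \<ge> 1" "d \<ge> 1" "R ^^ (i + d) = R ^^ i"
    using ij0 by (auto simp: i_def d_def min_def max_def)
  have step: "R ^^ (i + e + d) = R ^^ (i + e)" for e
    using i(3) relpow_add[of "i + d" e R] relpow_add[of i e R] by (simp add: ac_simps)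
  have steps: "R ^^ (i + e + c * d) = R ^^ (i + e)" for c e
  proof (induction c)
    case (Suc c)
    have "i + e + Suc c * d = i + (e + c * d) + d" by simp
    then show ?case using step[of "e + c * d"] Suc by (simp add: ac_simps)
  qed simp
  \<comment> \<open>The exponent is a multiple of the period \<open>d\<close> and at least the
    preperiod \<open>i\<close>, so adding \<open>m\<close> to it changes nothing.\<close>
  define m where "m = i * d"
  have m: "m \<ge> i" "m \<ge> 1" using i by (simp_all add: m_def)
  have "R ^^ (m + m) = R ^^ m"
    using steps[of "m - i" i] m by (simp add: m_def)
  then have id: "R ^^ m = Id_on (Domain (R ^^ m))"
    using PRel_idempotent[OF PRel_relpow[OF R m(2)]] relpow_add[of m m R] by simp
  have "Domain (R ^^ m) \<subseteq> Domain R" "Range (R ^^ m) \<subseteq> Range R"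
    by (rule relpow_subset[OF m(2)])+
  moreover have "Range (R ^^ m) = Domain (R ^^ m)" using id by (metis Domain_Id_on Range_Id_on)
  ultimately show thesis
    using that[OF m(2) id] set_ring_Domain[OF PRel_relpow[OF R m(2)]] by simp
qed

lemma Domain_relpow_eq:
  assumes "Domain R = D" "Range R = D" "k \<ge> 1"
  shows "Domain (R ^^ k) = D \<and> Range (R ^^ k) = D"
  using assms(3)
proof (induction k rule: dec_induct)
  case (step k)
  then have S: "Range (R ^^ k) = Domain R" "Domain (R ^^ k) = D" using assms(1) by simp_all
  have "Domain (R ^^ k O R) = Domain (R ^^ k)" "Range (R ^^ k O R) = Range R"
    using S(1) by (blast, blast)
  then show ?case using S(2) assms(2) by simp
qed (use assms in simp)

section \<open>Closure properties of an isolated semigroup of relations\<close>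

locale isolated_rels =
  fixes n :: nat and T :: "(nat set \<times> nat set) set set"
  assumes ne: "T \<noteq> {}" and sub: "T \<subseteq> PRel n"
    and comp: "R \<in> T \<Longrightarrow> S \<in> T \<Longrightarrow> R O S \<in> T"
    and root: "R \<in> PRel n \<Longrightarrow> k \<ge> 1 \<Longrightarrow> R ^^ k \<in> T \<Longrightarrow> R \<in> T"
begin

lemma ring: "Id_on D \<in> T \<Longrightarrow> set_ring n D"
  using set_ring_Domain sub by force

lemma relpow: "R \<in> T \<Longrightarrow> k \<ge> 1 \<Longrightarrow> R ^^ k \<in> T"
proof (induction k)
  case (Suc k)
  then show ?case using comp by (cases "k = 0") auto
qed simp

lemma inter: "Id_on D \<in> T \<Longrightarrow> Id_on E \<in> T \<Longrightarrow> Id_on (D \<inter> E) \<in> T"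
proof -
  have "Id_on D O Id_on E = Id_on (D \<inter> E)" by auto
  then show "Id_on D \<in> T \<Longrightarrow> Id_on E \<in> T \<Longrightarrow> Id_on (D \<inter> E) \<in> T" using comp by metis
qed

text \<open>Some power of \<open>R\<close> is an idempotent. It is its own converse, so the converse
  of \<open>R\<close> is a root of the same element of \<open>T\<close>.\<close>

lemma converse:
  assumes "R \<in> T"
  shows "R\<inverse> \<in> T"
proof -
  have R: "R \<in> PRel n" using assms sub by blast
  obtain k D where k: "k \<ge> 1" "R ^^ k = Id_on D" using ex_idempotent_relpow[OF R] .
  have "(R\<inverse>) ^^ k = (R ^^ k)\<inverse>"
  proof (induction k)
    case (Suc k)
    then have "(R\<inverse>) ^^ Suc k = (R O R ^^ k)\<inverse>" by (simp add: converse_relcomp)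
    then show ?case by (simp add: relpow_commute)
  qed auto
  then have "(R\<inverse>) ^^ k \<in> T" using relpow[OF assms k(1)] k by (simp add: converse_Id_on)
  then show ?thesis using root PRel_converse[OF R] k(1) by blast
qed

lemma Id_Domain:
  assumes "R \<in> T"
  shows "Id_on (Domain R) \<in> T"
proof -
  have "R O R\<inverse> = Id_on (Domain R)" using PRel_comp_converse assms sub by blast
  then show ?thesis using comp[OF assms converse[OF assms]] by simp
qed

lemma Id_Range: "R \<in> T \<Longrightarrow> Id_on (Range R) \<in> T"
  using Id_Domain[OF converse] by simp

text \<open>All powers of such an \<open>R\<close> keep domain and range \<open>D\<close>, so its
  idempotent power is the identity on \<open>D\<close>, and \<open>R\<close> is a root of
  it.\<close>

lemma group_mem:
  assumes "R \<in> PRel n" "Domain R = D" "Range R = D" "Id_on D \<in> T"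
  shows "R \<in> T"
proof -
  obtain k E where k: "k \<ge> 1" "R ^^ k = Id_on E" using ex_idempotent_relpow[OF assms(1)] .
  then have "E = D" using Domain_relpow_eq[OF assms(2,3) k(1)] by auto
  then show ?thesis using root[OF assms(1) k(1)] k(2) assms(4) by simp
qed

lemma conjugate:
  assumes "R \<in> T" "Id_on E \<in> T" "E \<subseteq> Domain R"
  shows "Id_on (R `` E) \<in> T"
proof -
  have "R\<inverse> O Id_on E O R = Id_on (R `` E)"
  proof (intro equalityI subrelI)
    fix B B' assume "(B, B') \<in> R\<inverse> O Id_on E O R"
    then obtain A where "A \<in> E" "(A, B) \<in> R" "(A, B') \<in> R" by blast
    then show "(B, B') \<in> Id_on (R `` E)" using PRel_functional assms(1) sub by blast
  qed blast
  then show ?thesis using comp[OF converse[OF assms(1)] comp[OF assms(2,1)]] by metis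
qed

text \<open>Interchanging the classes of \<open>v\<close> and \<open>w\<close> is an element of the
  group at \<open>D\<close>, which lies in \<open>T\<close>; \<open>E'\<close> is the conjugate of
  \<open>E\<close> by it. The class of 0 cannot take part, since a labelling ties the two copies of
  0 together. The one-sided description of \<open>E'\<close> suffices: it is applied to members of
  the least ring, which are known to lie in \<open>E'\<close>.\<close>

lemma swap:
  assumes D: "Id_on D \<in> T" and E: "Id_on E \<in> T" "E \<subseteq> D"
    and vw: "v \<le> n" "w \<le> n" "\<not> indist D v w" "\<not> indist D v 0" "\<not> indist D w 0"
  obtains E' where "Id_on E' \<in> T"
    "\<And>B. B \<in> E' \<Longrightarrow> \<exists>A\<in>E. (v \<in> A \<longleftrightarrow> w \<in> B) \<and> (w \<in> A \<longleftrightarrow> v \<in> B) \<and>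
       (\<forall>u\<le>n. \<not> indist D u v \<longrightarrow> \<not> indist D u w \<longrightarrow> (u \<in> A \<longleftrightarrow> u \<in> B))"
proof -
  have rD: "set_ring n D" using ring[OF D] .
  obtain p :: "nat \<Rightarrow> nat" where p: "\<And>x y. p x = p y \<longleftrightarrow> indist D x y"
    using indist_labels by blast
  define q where "q x = (if p x = p v then p w else if p x = p w then p v else p x)" for x
  have q0: "q 0 = p 0" using vw p indist_sym by (auto simp: q_def)
  have vw': "p v \<noteq> p w" using p vw by simp
  have qv: "q v = p w" "q w = p v" by (auto simp: q_def)
  have "q ` {0..n} = p ` {0..n}"
  proof (intro equalityI subsetI)
    fix i assume "i \<in> q ` {0..n}"
    then obtain x where "x \<le> n" "i = q x" by auto
    then show "i \<in> p ` {0..n}" using vw by (auto simp: q_def)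
  next
    fix i assume "i \<in> p ` {0..n}"
    then obtain x where x: "x \<le> n" "i = p x" by auto
    consider "i = p v" | "i = p w" | "i \<noteq> p v" "i \<noteq> p w" by blast
    then show "i \<in> q ` {0..n}"
    proof cases
      case 3
      then have "q x = i" using x by (simp add: q_def)
      then show ?thesis using x by force
    qed (use qv vw in force)+
  qed
  then have l: "labelling n p q" using q0 by (simp add: labelling_def)
  let ?R = "lab_rel n p q"
  have qp: "q x = q y \<longleftrightarrow> p x = p y" for x y
    using vw' by (auto simp: q_def)
  have "Domain ?R = Domain (lab_rel n p p)" "Range ?R = Domain (lab_rel n p p)"
    using Domain_lab_rel[OF l] Domain_lab_rel[of n p p] Domain_lab_rel[OF labelling_sym[OF l]]
      converse_lab_rel[of n p q] qp by (auto simp: labelling_def simp flip: Domain_converse)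
  then have dom: "Domain ?R = D" "Range ?R = D" using lab_rel_refl[OF rD p] by simp_all
  then have "?R \<in> T" using group_mem[OF lab_rel_PRel[OF l]] D by blast
  then have "Id_on (?R `` E) \<in> T" using conjugate E dom by blast
  moreover have "\<exists>A\<in>E. (v \<in> A \<longleftrightarrow> w \<in> B) \<and> (w \<in> A \<longleftrightarrow> v \<in> B) \<and>
       (\<forall>u\<le>n. \<not> indist D u v \<longrightarrow> \<not> indist D u w \<longrightarrow> (u \<in> A \<longleftrightarrow> u \<in> B))"
    if "B \<in> ?R `` E" for B
  proof -
    from that obtain A where A: "A \<in> E" "(A, B) \<in> ?R" by auto
    show ?thesis
      using A(1) lab_relD(5)[OF A(2)] vw(1,2) qv by (intro bexI[of _ A]) (auto simp: q_def p)
  qed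
  ultimately show thesis by (rule that)
qed

text \<open>The root of the idempotent with the classes of \<open>x\<close> and \<open>y\<close> merged is the map that moves the single
element \<open>x\<close> from its class to that of \<open>y\<close>.  Either class may be that of \<open>0\<close>, but \<open>x\<close> is not \<open>0\<close> itself.\<close>

lemma split_class:
  assumes D: "set_ring n D" and x: "x \<le> n" "x \<noteq> 0" and x': "x' \<le> n" "x' \<noteq> x" "indist D x x'"
    and y: "y \<le> n" "\<not> indist D x y"
    and T: "Id_on {A \<in> D. x \<in> A \<longleftrightarrow> y \<in> A} \<in> T"
  shows "Id_on D \<in> T"
proof -
  obtain p :: "nat \<Rightarrow> nat" where p: "\<And>x y. p x = p y \<longleftrightarrow> indist D x y"
    using indist_labels by blast
  define q where "q = p(x := p y)"
  have qx: "q x = p y" and qo: "\<And>z. z \<noteq> x \<Longrightarrow> q z = p z" by (auto simp: q_def)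
  have "q ` {0..n} = p ` {0..n}"
  proof (intro equalityI subsetI)
    fix i assume "i \<in> q ` {0..n}"
    then show "i \<in> p ` {0..n}" using y by (auto simp: q_def)
  next
    fix i assume "i \<in> p ` {0..n}"
    then obtain z where z: "z \<le> n" "i = p z" by auto
    show "i \<in> q ` {0..n}"
    \<comment> \<open>The old label of \<open>x\<close> survives at \<open>x'\<close>; this is why
      the class must have a second element.\<close>
    proof (cases "z = x")
      case True
      then have "i = q x'" using z qo x' p by simp
      then show ?thesis using x' by simp
    next
      case False
      then have "i = q z" using z qo by simp
      then show ?thesis using z by simp
    qed
  qed
  then have l: "labelling n p q" using x(2) by (simp add: labelling_def q_def)
  let ?R = "lab_rel n p q"
  have dom: "Domain ?R = D"
    using Domain_lab_rel[OF l] Domain_lab_rel[of n p p] lab_rel_refl[OF D p]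
    by (simp add: labelling_def)
  have R: "?R \<in> PRel n" using lab_rel_PRel[OF l] .
  have diag: "(A, A) \<in> ?R" if A: "A \<in> D" "x \<in> A \<longleftrightarrow> y \<in> A" for A
  proof -
    have "u \<in> A \<longleftrightarrow> z \<in> A" if "p u = q z" for u z
      using that A p by (cases "z = x") (auto simp: qx qo dest: indistD)
    then show ?thesis using set_ring_subset[OF D A(1)] by (simp add: lab_rel_def)
  qed
  have "?R O ?R = Id_on {A \<in> D. x \<in> A \<longleftrightarrow> y \<in> A}"
  proof (intro equalityI subrelI)
    fix A C assume "(A, C) \<in> ?R O ?R"
    then obtain B where B: "(A, B) \<in> ?R" "(B, C) \<in> ?R" by blast
    then have AD: "A \<in> D" and BD: "B \<in> D" using dom by blast+
    have same: "z \<in> A \<longleftrightarrow> z \<in> B" if "z \<noteq> x" for z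
    proof (cases "z \<le> n")
      case True
      then show ?thesis using lab_relD(5)[OF B(1) True True] qo[OF that] by simp
    next
      case False
      then show ?thesis using lab_relD(1,2)[OF B(1)] by auto
    qed
    \<comment> \<open>Only \<open>x\<close> has moved, and both sets treat \<open>x\<close> like
      \<open>x'\<close>, where they already agree.\<close>
    have "x \<in> A \<longleftrightarrow> x \<in> B"
      using indistD[OF x'(3) AD] indistD[OF x'(3) BD] same[OF x'(2)] by simp
    then have "A = B" using same by (intro set_eqI) metis
    moreover have "y \<in> A \<longleftrightarrow> x \<in> B" using lab_relD(5)[OF B(1) y(1) x(1)] qx by simp
    ultimately have A: "x \<in> A \<longleftrightarrow> y \<in> A" by blast
    then have "(B, A) \<in> ?R" using diag AD \<open>A = B\<close> by simp
    then have "C = A" using B(2) PRel_functional[OF R] by blast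
    then show "(A, C) \<in> Id_on {A \<in> D. x \<in> A \<longleftrightarrow> y \<in> A}" using AD A by blast
  qed (use diag in blast)
  then have "?R ^^ 2 \<in> T" using T by (simp add: numeral_2_eq_2)
  then have "?R \<in> T" using root[OF R, of 2] by simp
  then show ?thesis using Id_Domain dom by metis
qed

text \<open>Here the root interchanges the class of \<open>x\<close> with the union of those of \<open>z\<close> and \<open>z'\<close>.\<close>

lemma split_pair:
  assumes D: "set_ring n D"
    and x: "x \<le> n" "x' \<le> n" "x' \<noteq> x" "indist D x x'" "\<not> indist D x 0"
    and z: "z \<le> n" "\<not> indist D x z" "\<not> indist D z 0"
    and z': "z' \<le> n" "\<not> indist D x z'" "\<not> indist D z' 0" "\<not> indist D z z'"
    and T: "Id_on {A \<in> D. z \<in> A \<longleftrightarrow> z' \<in> A} \<in> T"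
  shows "Id_on D \<in> T"
proof -
  obtain p :: "nat \<Rightarrow> nat" where p: "\<And>x y. p x = p y \<longleftrightarrow> indist D x y"
    using indist_labels by blast
  have px: "p x' = p x" "p x \<noteq> p z" "p x \<noteq> p z'" "p z \<noteq> p z'"
    "p x \<noteq> p 0" "p z \<noteq> p 0" "p z' \<noteq> p 0"
    using p x z z' indist_sym by auto
  \<comment> \<open>The map sends the class of \<open>x\<close> to the union of the classes of
    \<open>z\<close> and \<open>z'\<close>, the class of \<open>z\<close> to \<open>x\<close> alone,
    and the class of \<open>z'\<close> to the rest of the class of \<open>x\<close>. Its square
    therefore fixes the sets that do not separate \<open>z\<close> from \<open>z'\<close> and is
    undefined elsewhere.\<close>
  define q where "q u = (if p u = p z \<or> p u = p z' then p x
     else if p u = p x then (if u = x then p z else p z') else p u)" for u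
  have q: "q z = p x" "q z' = p x" "q x = p z" "q x' = p z'" "q 0 = p 0"
    using px x by (auto simp: q_def)
  have "q ` {0..n} = p ` {0..n}"
  proof (intro equalityI subsetI)
    fix i assume "i \<in> q ` {0..n}"
    then obtain u where "u \<le> n" "i = q u" by auto
    then show "i \<in> p ` {0..n}" using x(1) z(1) z'(1) by (auto simp: q_def)
  next
    fix i assume "i \<in> p ` {0..n}"
    then obtain u where u: "u \<le> n" "i = p u" by auto
    consider "i = p x" | "i = p z" | "i = p z'" | "i \<noteq> p x" "i \<noteq> p z" "i \<noteq> p z'" by blast
    then have "\<exists>w\<le>n. q w = i"
    proof cases
      case 4
      then have "q u = i" using u by (simp add: q_def)
      then show ?thesis using u by blast
    qed (use q x z z' in blast)+
    then show "i \<in> q ` {0..n}" by force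
  qed
  then have l: "labelling n p q" using q by (simp add: labelling_def)
  let ?R = "lab_rel n p q"
  have dom: "Domain ?R = D"
    using Domain_lab_rel[OF l] Domain_lab_rel[of n p p] lab_rel_refl[OF D p]
    by (simp add: labelling_def)
  have R: "?R \<in> PRel n" using lab_rel_PRel[OF l] .
  have sat: "u \<in> A \<longleftrightarrow> w \<in> A" if "A \<in> D" "p u = p w" for A u w
    using that p indistD by blast
  have "?R O ?R = Id_on {A \<in> D. z \<in> A \<longleftrightarrow> z' \<in> A}"
  proof (intro equalityI subrelI)
    fix A C assume "(A, C) \<in> ?R O ?R"
    then obtain B where B: "(A, B) \<in> ?R" "(B, C) \<in> ?R" by blast
    then have AD: "A \<in> D" and BD: "B \<in> D" using dom by blast+
    note AB = lab_relD(5)[OF B(1)] and BC = lab_relD(5)[OF B(2)]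
    have e1: "z \<in> A \<longleftrightarrow> x \<in> B" "z' \<in> A \<longleftrightarrow> x' \<in> B" "x \<in> A \<longleftrightarrow> z \<in> B" "x \<in> A \<longleftrightarrow> z' \<in> B"
      using AB[OF z(1) x(1)] AB[OF z'(1) x(2)] AB[OF x(1) z(1)] AB[OF x(1) z'(1)] q by simp_all
    \<comment> \<open>\<open>B\<close> lies in the domain of the second factor, so it cannot
      separate \<open>x\<close> from \<open>x'\<close>; this is what keeps \<open>A\<close> from
      separating \<open>z\<close> from \<open>z'\<close>.\<close>
    have xB: "x \<in> B \<longleftrightarrow> x' \<in> B" using sat[OF BD] px by metis
    have "u \<in> A \<longleftrightarrow> u \<in> C" if u: "u \<le> n" for u
    proof -
      consider "p u = p x" "u = x" | "p u = p x" "u \<noteq> x" | "p u = p z" | "p u = p z'"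
        | "p u \<noteq> p x" "p u \<noteq> p z" "p u \<noteq> p z'" by blast
      then show ?thesis
      proof cases
        case 1
        then show ?thesis using e1 BC[OF z(1) u] q by simp
      next
        case 2
        then have "q u = p z'" using px by (simp add: q_def)
        then show ?thesis using 2 e1 sat[OF AD, of u x] BC[OF z'(1) u] by simp
      next
        case 3
        then have "q u = p x" by (simp add: q_def)
        then show ?thesis using 3 e1 sat[OF AD, of u z] BC[OF x(1) u] by simp
      next
        case 4
        then have "q u = p x" by (simp add: q_def)
        then show ?thesis using 4 e1 xB sat[OF AD, of u z'] BC[OF x(1) u] by simp
      next
        case 5
        then have "q u = p u" by (simp add: q_def)
        then show ?thesis using AB[OF u u] BC[OF u u] by simp
      qed
    qed
    moreover have "A \<subseteq> {1..n}" "C \<subseteq> {1..n}" using lab_relD(1,2) B by blast+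
    ultimately have "A = C" by fastforce
    then show "(A, C) \<in> Id_on {A \<in> D. z \<in> A \<longleftrightarrow> z' \<in> A}" using AD e1 xB by blast
  next
    fix A C assume "(A, C) \<in> Id_on {A \<in> D. z \<in> A \<longleftrightarrow> z' \<in> A}"
    then have A: "A \<in> D" "z \<in> A \<longleftrightarrow> z' \<in> A" and C: "C = A" by auto
    \<comment> \<open>The image of \<open>A\<close> exchanges the membership of \<open>x\<close>
      with the common membership of \<open>z\<close> and \<open>z'\<close>. The exchange is an
      involution, which gives both factors at once.\<close>
    define B where "B = {u. u \<le> n \<and>
      (if p u = p z \<or> p u = p z' then x \<in> A else if p u = p x then z \<in> A else u \<in> A)}"
    have B: "u \<in> B \<longleftrightarrow>
      (if p u = p z \<or> p u = p z' then x \<in> A else if p u = p x then z \<in> A else u \<in> A)"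
      if "u \<le> n" for u using that by (simp add: B_def)
    have A0: "A \<subseteq> {1..n}" using set_ring_subset[OF D A(1)] .
    have "0 \<notin> B" using px A0 by (auto simp: B_def)
    moreover have "B \<subseteq> {0..n}" by (auto simp: B_def)
    ultimately have B0: "B \<subseteq> {1..n}"
by (rule subset_from_one[rotated])
    have AB: "w \<in> B \<longleftrightarrow> u \<in> A" "u \<in> B \<longleftrightarrow> w \<in> A"
      if uw: "u \<le> n" "w \<le> n" "p u = q w" for u w
    proof -
      note s = sat[OF A(1)]
      consider "p w = p z \<or> p w = p z'" | "p w = p x" "p u = p z \<or> p u = p z'"
        | "p w \<noteq> p x" "p w \<noteq> p z" "p w \<noteq> p z'" "p u = p w"
        using uw(3) by (auto simp: q_def split: if_splits)
      then have "(w \<in> B \<longleftrightarrow> u \<in> A) \<and> (u \<in> B \<longleftrightarrow> w \<in> A)"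
      proof cases
        case 1
        then have u: "p u = p x" using uw(3) by (auto simp: q_def)
        have "w \<in> A \<longleftrightarrow> z \<in> A" using 1 s[of w z] s[of w z'] A(2) by blast
        then show ?thesis using 1 u s[OF u] px B[OF uw(1)] B[OF uw(2)] by simp
      next
        case 2
        have "u \<in> A \<longleftrightarrow> z \<in> A" using 2 s[of u z] s[of u z'] A(2) by blast
        then show ?thesis using 2 s[OF 2(1)] px B[OF uw(1)] B[OF uw(2)] by simp
      next
        case 3
        then show ?thesis using s[OF 3(4)] B[OF uw(1)] B[OF uw(2)] by simp
      qed
      then show "w \<in> B \<longleftrightarrow> u \<in> A" "u \<in> B \<longleftrightarrow> w \<in> A" by blast+
    qed
    then have "(A, B) \<in> ?R" "(B, A) \<in> ?R" using A0 B0 by (simp_all add: lab_rel_def)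
    then show "(A, C) \<in> ?R O ?R" using C by blast
  qed
  then have "?R ^^ 2 \<in> T" using T by (simp add: numeral_2_eq_2)
  then have "?R \<in> T" using root[OF R, of 2] by simp
  then show ?thesis using Id_Domain dom by metis
qed

end

section \<open>Isolated semigroups of relations: classification\<close>

text \<open>For \<open>Y\<close> inside {1..n}: in the partition, \<open>W\<close> becomes one
  class, the complement of \<open>Y\<close> joins 0, and the other elements of \<open>Y\<close> are
  singletons. If \<open>W\<close> contains 0, its elements lie in no member of the ring.\<close>

definition block_ring :: "nat set \<Rightarrow> nat set \<Rightarrow> nat set set" where
  "block_ring Y W = {A. A \<subseteq> Y \<and> (\<forall>x\<in>W. \<forall>y\<in>W. x \<in> A \<longleftrightarrow> y \<in> A)}"

text \<open>Dropping all constraints that mention \<open>v\<close> makes a positive \<open>v\<close>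
  \<le> n a class of its own and leaves the rest of the partition alone.\<close>

definition split_off :: "nat \<Rightarrow> nat set set \<Rightarrow> nat \<Rightarrow> nat set set" where
  "split_off n D v = {A. A \<subseteq> {1..n} \<and>
     (\<forall>x y. x \<le> n \<and> y \<le> n \<and> x \<noteq> v \<and> y \<noteq> v \<and> indist D x y \<longrightarrow> (x \<in> A \<longleftrightarrow> y \<in> A))}"

text \<open>The maximal subgroup at \<open>Id_on D\<close>, written without Green's relations;
  \<open>Gclass_eq\<close> makes the link.\<close>

definition H_rel :: "nat \<Rightarrow> nat set set \<Rightarrow> (nat set \<times> nat set) set set" where
  "H_rel n D = {R \<in> PRel n. Domain R = D \<and> Range R = D}"

text \<open>Relating \<open>Y\<close> to itself says that lines cover \<open>Y\<close> on both
  sides; the inclusions say that no line leaves \<open>Y\<close>.\<close>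

definition M_rel :: "nat \<Rightarrow> nat set \<Rightarrow> (nat set \<times> nat set) set set" where
  "M_rel n Y = {R \<in> PRel n. (Y, Y) \<in> R \<and> Domain R \<subseteq> Pow Y \<and> Range R \<subseteq> Pow Y}"

lemma set_ring_block_ring:
  assumes "Y \<subseteq> {1..n}" "W \<subseteq> {0..n}"
  shows "set_ring n (block_ring Y W)"
proof -
  have "block_ring Y W = Pow Y \<inter>
      {A. A \<subseteq> {1..n} \<and> (\<forall>x y. x \<in> W \<and> y \<in> W \<longrightarrow> (x \<in> A \<longleftrightarrow> y \<in> A))}"
    using assms(1) unfolding block_ring_def by blast
  moreover have "set_ring n {A. A \<subseteq> {1..n} \<and> (\<forall>x y. x \<in> W \<and> y \<in> W \<longrightarrow> (x \<in> A \<longleftrightarrow> y \<in> A))}"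
    by (rule set_ring_Collect) (use assms(2) in auto)
  ultimately show ?thesis using set_ring_Int[OF set_ring_Pow[OF assms(1)]] by simp
qed

lemma block_ring_pair: "A \<in> block_ring Y {x, y} \<longleftrightarrow> A \<subseteq> Y \<and> (x \<in> A \<longleftrightarrow> y \<in> A)"
  by (auto simp: block_ring_def)

lemma set_ring_split_off: "set_ring n (split_off n D v)"
  unfolding split_off_def by (rule set_ring_Collect) blast

lemma split_off_subset: "set_ring n D \<Longrightarrow> D \<subseteq> split_off n D v"
  unfolding split_off_def by (auto dest: indistD) (use set_ring_subset in fastforce)+

lemma split_off_indist:
  "indist D x y \<Longrightarrow> x \<le> n \<Longrightarrow> y \<le> n \<Longrightarrow> x \<noteq> v \<Longrightarrow> y \<noteq> v \<Longrightarrow> indist (split_off n D v) x y"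
  unfolding indist_def[of "split_off n D v"] by (simp add: split_off_def)

lemma split_off_sep:
  assumes "1 \<le> v" "v \<le> n" "y \<noteq> v"
  shows "\<not> indist (split_off n D v) v y"
proof -
  have "{v} \<in> split_off n D v" using assms by (auto simp: split_off_def)
  then show ?thesis using assms(3) by (auto dest: indistD)
qed

lemma split_off_merge:
  assumes D: "set_ring n D" and u: "u \<le> n" "u \<noteq> v" "v \<le> n" "indist D u v"
  shows "{A \<in> split_off n D v. u \<in> A \<longleftrightarrow> v \<in> A} = D"
proof (intro equalityI subsetI)
  fix A assume "A \<in> {A \<in> split_off n D v. u \<in> A \<longleftrightarrow> v \<in> A}"
  then have A: "A \<subseteq> {1..n}" "u \<in> A \<longleftrightarrow> v \<in> A"
    "\<And>x y. x \<le> n \<Longrightarrow> y \<le> n \<Longrightarrow> x \<noteq> v \<Longrightarrow> y \<noteq> v \<Longrightarrow> indist D x y \<Longrightarrow> x \<in> A \<longleftrightarrow> y \<in> A"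
    by (auto simp: split_off_def)
  show "A \<in> D"
  proof (rule set_ring_memI[OF D A(1)])
    fix x y assume xy: "x \<le> n" "y \<le> n" "indist D x y" "x \<in> A"
    \<comment> \<open>\<open>r\<close> replaces \<open>v\<close> by its classmate \<open>u\<close>,
      which recovers the constraints that \<open>split_off\<close> dropped.\<close>
    define r where "r z = (if z = v then u else z)" for z
    have r: "r z \<in> A \<longleftrightarrow> z \<in> A" "r z \<noteq> v" "indist D (r z) z" for z
      using A(2) u by (auto simp: r_def)
    have "r x \<le> n" "r y \<le> n" using xy u by (auto simp: r_def)
    moreover have "indist D (r x) (r y)" using r(3) xy(3) indist_trans indist_sym by metis
    ultimately show "y \<in> A" using A(3)[of "r x" "r y"] r xy(4) by simp
  qed
next
  fix A assume "A \<in> D"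
  then show "A \<in> {A \<in> split_off n D v. u \<in> A \<longleftrightarrow> v \<in> A}"
    using split_off_subset[OF D] indistD[OF u(4)] by blast
qed

lemma ex_indist_pair:
  assumes D: "set_ring n D" "Y \<in> D" "D \<subseteq> Pow Y" "D \<noteq> Pow Y"
  shows "\<exists>x\<in>Y. \<exists>y\<in>Y. x \<noteq> y \<and> indist D x y"
proof (rule ccontr)
  assume no: "\<not> (\<exists>x\<in>Y. \<exists>y\<in>Y. x \<noteq> y \<and> indist D x y)"
  have "A \<in> D" if A: "A \<subseteq> Y" for A
  proof (rule set_ring_memI[OF D(1)])
    show "A \<subseteq> {1..n}" using A set_ring_subset[OF D(1,2)] by blast
    fix x y assume xy: "indist D x y" "x \<in> A"
    then have "x \<in> Y" using A by blast
    moreover have "y \<in> Y" using calculation indistD[OF xy(1) D(2)] by simp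
    ultimately have "x = y" using no xy(1) by blast
    then show "y \<in> A" using xy(2) by simp
  qed
  then show False using D(3,4) by blast
qed

text \<open>Merging a single pair gives a ring directly below \<open>Pow Y\<close>. A ring above it
  has all other elements of \<open>Y\<close> as singleton classes, so only the pair itself can be
  merged or separated.\<close>

lemma ring_between:
  assumes E: "set_ring n E" and Y: "Y \<subseteq> {1..n}" and xy: "x \<in> Y" "y \<in> Y"
    and sub: "block_ring Y {x, y} \<subseteq> E" "E \<subseteq> Pow Y"
  shows "E = block_ring Y {x, y} \<or> E = Pow Y"
proof (rule disjCI)
  assume "E \<noteq> Pow Y"
  then obtain A where A: "A \<subseteq> Y" "A \<notin> E" using sub(2) by blast
  have "indist E x y"
  proof (rule ccontr)
    assume sep: "\<not> indist E x y"
    have "A \<in> E"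
    proof (rule set_ring_memI[OF E])
      show "A \<subseteq> {1..n}" using A Y by blast
      fix u v assume uv: "indist E u v" "u \<in> A"
      have uY: "u \<in> Y" using uv A by blast
      show "v \<in> A"
      proof (cases "u \<in> {x, y}")
        case False
        then have "{u} \<in> E" using uY sub(1) by (auto simp: block_ring_pair)
        then show ?thesis using indistD[OF uv(1)] uv(2) by auto
      next
        case True
        have "{x, y} \<in> E" using sub(1) xy by (auto simp: block_ring_pair)
        then have "v \<in> {x, y}" using indistD[OF uv(1)] True by blast
        then have "v = u" using uv(1) True sep indist_sym by blast
        then show ?thesis using uv(2) by simp
      qed
    qed
    then show False using A(2) by simp
  qed
  then have "A \<in> block_ring Y {x, y}" if "A \<in> E" for A
    using indistD[of E x y A] sub(2) that unfolding block_ring_pair by blast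
  then show "E = block_ring Y {x, y}" using sub(1) by blast
qed

text \<open>\<open>R\<close> is a bijection from its domain to its range, so one inclusion between
  finite sets of equal size is enough.\<close>

lemma H_rel_eq_if_Domain:
  assumes R: "R \<in> PRel n" and "Domain R = D" "Range R \<subseteq> D"
  shows "R \<in> H_rel n D"
proof -
  have "card (Range R) = card (Domain R)"
  proof (rule bij_betw_same_card[symmetric])
    define f where "f A = (THE B. (A, B) \<in> R)" for A
    have f: "f A = B" if "(A, B) \<in> R" for A B
      unfolding f_def by (rule the_equality) (use that PRel_functional[OF R] in blast)+
    have "inj_on f (Domain R)"
    proof (rule inj_onI)
      fix A A' assume "A \<in> Domain R" "A' \<in> Domain R" "f A = f A'"
      then obtain B where "(A, B) \<in> R" "(A', B) \<in> R" using f by (metis DomainE)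
      then show "A = A'" using PRel_injective[OF R] by blast
    qed
    moreover have "f ` Domain R = Range R" using f by (force simp: image_iff)
    ultimately show "bij_betw f (Domain R) (Range R)" by (simp add: bij_betw_def)
  qed
  then have "Range R = D"
    using assms finite_set_ring[OF set_ring_Domain[OF R]] by (intro card_subset_eq) auto
  then show ?thesis using assms by (simp add: H_rel_def)
qed

lemma H_rel_eq_if_Range:
  assumes R: "R \<in> PRel n" and "Range R = D" "Domain R \<subseteq> D"
  shows "R \<in> H_rel n D"
  using H_rel_eq_if_Domain[OF PRel_converse[OF R], of D] assms by (auto simp: H_rel_def)

lemma relpow_fixed: "(Y, Y) \<in> R \<Longrightarrow> (Y, Y) \<in> R ^^ k"
  by (induction k) auto

lemma M_rel_subset_H: "Y \<subseteq> {1..n} \<Longrightarrow> H_rel n (Pow Y) \<subseteq> M_rel n Y"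
  using PRel_Union by (fastforce simp: H_rel_def M_rel_def)

section \<open>The least idempotent and what it forces\<close>

context isolated_rels
begin

text \<open>A ring of least cardinality is contained in every other, since its intersection with any
  of them again belongs to \<open>T\<close>.\<close>

lemma least_ring:
  obtains D0 where "Id_on D0 \<in> T" "\<And>D. Id_on D \<in> T \<Longrightarrow> D0 \<subseteq> D"
proof -
  obtain R where "R \<in> T" using ne by blast
  then have "Id_on (Domain R) \<in> T" by (rule Id_Domain)
  then obtain D0 where D0: "Id_on D0 \<in> T" "\<And>D. Id_on D \<in> T \<Longrightarrow> card D0 \<le> card D"
    using ex_has_least_nat[of "\<lambda>D. Id_on D \<in> T" "Domain R" card] by blast
  have "D0 \<subseteq> D" if "Id_on D \<in> T" for D
  proof -
    have "D0 \<inter> D = D0"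
      using D0(2)[OF inter[OF D0(1) that]] finite_set_ring[OF ring[OF D0(1)]]
      by (intro card_seteq) auto
    then show ?thesis by blast
  qed
  then show thesis using that D0(1) by blast
qed

lemma mem_if_idempotent_power:
  assumes R: "R \<in> PRel n"
    and "\<And>k D. k \<ge> 1 \<Longrightarrow> R ^^ k = Id_on D \<Longrightarrow> set_ring n D \<Longrightarrow> D \<subseteq> Domain R \<Longrightarrow> D \<subseteq> Range R
      \<Longrightarrow> Id_on D \<in> T"
  shows "R \<in> T"
proof -
  obtain k D where k: "k \<ge> 1" "R ^^ k = Id_on D" "set_ring n D" "D \<subseteq> Domain R" "D \<subseteq> Range R"
    using ex_idempotent_relpow[OF R] .
  then show ?thesis using root[OF R k(1)] assms(2)[OF k] by simp
qed

lemma H_rel_subset: "Id_on D \<in> T \<Longrightarrow> H_rel n D \<subseteq> T"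
  using group_mem by (auto simp: H_rel_def)

lemma H_rel_cases: "H_rel n D \<subseteq> T \<or> H_rel n D \<inter> T = {}"
proof (rule disjCI)
  assume "H_rel n D \<inter> T \<noteq> {}"
  then obtain R where "R \<in> T" "Domain R = D" by (auto simp: H_rel_def)
  then show "H_rel n D \<subseteq> T" using H_rel_subset Id_Domain by blast
qed

text \<open>The tool behind every contradiction with minimality. Suppose \<open>D0\<close> arises
  from \<open>D\<close> by merging \<open>u\<close> and \<open>v\<close>. Interchanging the classes
  of \<open>v\<close> and \<open>w\<close> in \<open>D\<close> gives a ring in which
  \<open>u\<close> is merged with \<open>w\<close> instead. It contains \<open>D0\<close>, so
  \<open>D0\<close> cannot separate \<open>u\<close> from \<open>w\<close> either. Here
  \<open>u\<close> may be 0, but \<open>v\<close> and \<open>w\<close> must lie outside the class of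
  0.\<close>

lemma no_swap:
  assumes D0: "Id_on D0 \<in> T" "\<And>D. Id_on D \<in> T \<Longrightarrow> D0 \<subseteq> D"
    and D: "Id_on D \<in> T" "D0 = {A \<in> D. u \<in> A \<longleftrightarrow> v \<in> A}"
    and uv: "u \<le> n" "v \<le> n" "\<not> indist D u v" "\<not> indist D v 0" and w: "w \<in> \<Union>D0"
  shows "indist D0 u w"
proof (rule ccontr)
  assume sep: "\<not> indist D0 u w"
  have sub: "D0 \<subseteq> D" using D(2) by blast
  have w0: "\<not> indist D w 0"
    using indist_zero_iff[OF ring[OF D(1)]] w sub by blast
  have uvD0: "indist D0 u v" using D(2) by (simp add: indist_def)
  have vw: "\<not> indist D v w" using sep uvD0 indist_trans indist_mono[OF _ sub] by blast
  have uw: "\<not> indist D u w" using sep indist_mono[OF _ sub] by blast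
  have "w \<le> n" using w set_ring_Union_subset[OF ring[OF D0(1)]] by auto
  then obtain E' where E': "Id_on E' \<in> T"
    "\<And>B. B \<in> E' \<Longrightarrow> \<exists>A\<in>D0. (v \<in> A \<longleftrightarrow> w \<in> B) \<and> (w \<in> A \<longleftrightarrow> v \<in> B) \<and>
       (\<forall>u\<le>n. \<not> indist D u v \<longrightarrow> \<not> indist D u w \<longrightarrow> (u \<in> A \<longleftrightarrow> u \<in> B))"
    using swap[OF D(1) D0(1) sub uv(2) _ vw uv(4) w0] by blast
  obtain B where B: "B \<in> D0" "(u \<in> B) \<noteq> (w \<in> B)" using sep by (auto simp: indist_def)
  then obtain A where "A \<in> D0" "v \<in> A \<longleftrightarrow> w \<in> B" "u \<in> A \<longleftrightarrow> u \<in> B"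
    using E'(2)[of B] D0(2)[OF E'(1)] uv(1,3) uw by blast
  then show False using B(2) indistD[OF uvD0] by blast
qed

text \<open>One large merged class gives all smaller ones: elements are released one at a time by
  \<open>split_class\<close> as long as two remain. The side condition allows 0 in \<open>W0\<close>
  only when \<open>Y\<close> is everything, so every released nonzero element lies in
  \<open>Y\<close>.\<close>

lemma block_rings:
  assumes Y: "Y \<subseteq> {1..n}" and W0: "W0 \<subseteq> {0..n}" "W0 \<subseteq> Y \<or> Y = {1..n}"
    and T: "Id_on (block_ring Y W0) \<in> T" and "W \<subseteq> W0" and "x \<in> W" "x' \<in> W" "x' \<noteq> x"
  shows "Id_on (block_ring Y W) \<in> T"
  using assms(5-)
proof (induction "card (W0 - W)" arbitrary: W)
  case 0
  have "finite (W0 - W)" using W0(1) finite_subset by blast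
  then have "W = W0" using 0 by simp
  then show ?case using T by simp
next
  case (Suc k)
  then obtain y where y: "y \<in> W0" "y \<notin> W" by (metis DiffE card.empty equals0I nat.distinct(1))
  have "finite (W0 - W)" using W0(1) finite_subset by blast
  moreover have "W0 - insert y W = (W0 - W) - {y}" by blast
  ultimately have "k = card (W0 - insert y W)" using Suc.hyps(2) y by (simp add: card_Diff_singleton)
  then have IH: "Id_on (block_ring Y (insert y W)) \<in> T"
    using Suc.hyps(1)[of "insert y W"] Suc.prems y by blast
  \<comment> \<open>The element that \<open>split_class\<close> moves must not be 0; one of the two
    elements of \<open>W\<close> qualifies.\<close>
  obtain z z' where z: "z \<in> W" "z \<noteq> 0" "z' \<in> W" "z' \<noteq> z"
    using Suc.prems by (cases "x = 0") metis+
  have le: "u \<le> n" if "u \<in> W0" for u using that W0(1) by auto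
  have WY: "u \<in> Y" if "u \<in> W0" "u \<noteq> 0" for u using that W0 le by fastforce
  have sep: "\<not> indist (block_ring Y W) z y"
  proof (cases "0 \<in> W")
    case True
    then have "y \<in> Y" using WY y by metis
    then have "{y} \<in> block_ring Y W" using y(2) by (auto simp: block_ring_def)
    then show ?thesis using y(2) z(1) by (auto dest: indistD)
  next
    case False
    then have "W \<subseteq> Y" using WY Suc.prems(1) by (metis subset_iff)
    then have "W \<in> block_ring Y W" by (auto simp: block_ring_def)
    then show ?thesis using y(2) z(1) by (auto dest: indistD)
  qed
  have eq: "{A \<in> block_ring Y W. z \<in> A \<longleftrightarrow> y \<in> A} = block_ring Y (insert y W)"
    using z(1) unfolding block_ring_def by blast
  show ?case
  proof (rule split_class)
    show "set_ring n (block_ring Y W)"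
      using set_ring_block_ring[OF Y] Suc.prems(1) W0(1) by blast
    show "indist (block_ring Y W) z z'" using z(1,3) unfolding indist_def block_ring_def by blast
    show "Id_on {A \<in> block_ring Y W. z \<in> A \<longleftrightarrow> y \<in> A} \<in> T" using IH eq by simp
  qed (use z y sep le Suc.prems(1) in auto)
qed

text \<open>A proper ring is the intersection of the rings of its merged pairs, and intersections
  are products. The induction starts from one pair, because the empty intersection
  \<open>Pow Y\<close> may fail to be in \<open>T\<close>.\<close>

lemma mem_if_pairs:
  assumes pairs: "\<And>x y. x \<in> W \<Longrightarrow> y \<in> W \<Longrightarrow> x \<noteq> y \<Longrightarrow> Id_on (block_ring Y {x, y}) \<in> T"
    and W: "finite W"
    and D: "D = {A. A \<subseteq> Y \<and> (\<forall>x\<in>W. \<forall>y\<in>W. indist D x y \<longrightarrow> (x \<in> A \<longleftrightarrow> y \<in> A))}" "D \<noteq> Pow Y"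
  shows "Id_on D \<in> T"
proof -
  define P where "P = {(x, y). x \<in> W \<and> y \<in> W \<and> x \<noteq> y \<and> indist D x y}"
  have "P \<subseteq> W \<times> W" by (auto simp: P_def)
  then have fin: "finite P" using W finite_subset by blast
  have eq: "D = {A. A \<subseteq> Y \<and> (\<forall>(x, y)\<in>P. x \<in> A \<longleftrightarrow> y \<in> A)}"
    by (subst D(1)) (auto simp: P_def)
  then have "P \<noteq> {}" using D(2) by (auto simp: Pow_def)
  have "Id_on {A. A \<subseteq> Y \<and> (\<forall>(x, y)\<in>Q. x \<in> A \<longleftrightarrow> y \<in> A)} \<in> T"
    if "finite Q" "Q \<noteq> {}" "Q \<subseteq> P" for Q
    using that
  proof (induction rule: finite_ne_induct)
    case (singleton q)
    then obtain x y where "q = (x, y)" "x \<in> W" "y \<in> W" "x \<noteq> y" by (auto simp: P_def)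
    moreover have "block_ring Y {x, y} = {A. A \<subseteq> Y \<and> (x \<in> A \<longleftrightarrow> y \<in> A)}" for x y
      by (auto simp: block_ring_pair)
    ultimately show ?case using pairs by simp
  next
    case (insert q Q)
    then obtain x y where q: "q = (x, y)" "x \<in> W" "y \<in> W" "x \<noteq> y" by (auto simp: P_def)
    have "{A. A \<subseteq> Y \<and> (\<forall>(x, y)\<in>insert q Q. x \<in> A \<longleftrightarrow> y \<in> A)} =
       block_ring Y {x, y} \<inter> {A. A \<subseteq> Y \<and> (\<forall>(x, y)\<in>Q. x \<in> A \<longleftrightarrow> y \<in> A)}"
      by (auto simp: block_ring_pair q(1))
    then show ?case using inter[OF pairs[OF q(2-4)]] insert by simp
  qed
  then show ?thesis using fin \<open>P \<noteq> {}\<close> eq by simp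
qed

text \<open>The zero element is the partition of {0..n} with a single class, from which every proper
  ring is reached. An element outside the group of units has an idempotent power with a proper ring,
  hence lies in \<open>T\<close>; the group of units is in \<open>T\<close> entirely or not at
  all.\<close>

lemma zero_case:
  assumes T: "Id_on {{}} \<in> T" and n: "n \<ge> 1"
  shows "T = PRel n \<or> T = PRel n - H_rel n (Pow {1..n})"
proof -
  have "A = {}" if A: "A \<subseteq> {1..n}" "\<forall>x\<in>{0..n}. \<forall>y\<in>{0..n}. x \<in> A \<longleftrightarrow> y \<in> A" for A
  proof -
    have "0 \<notin> A" using A(1) by auto
    then show ?thesis using A by (auto simp: subset_iff)
  qed
  then have "block_ring {1..n} {0..n} = {{}}" by (auto simp: block_ring_def)
  then have blk: "Id_on (block_ring {1..n} {x, y}) \<in> T" if "x \<in> {0..n}" "y \<in> {0..n}" "x \<noteq> y" for x y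
    using block_rings[of "{1..n}" "{0..n}" "{x, y}" x y] T that by auto
  have rings: "Id_on D \<in> T" if D: "set_ring n D" "D \<noteq> Pow {1..n}" for D
  proof (rule mem_if_pairs[OF blk])
    have "D = {A. A \<subseteq> {1..n} \<and> (\<forall>x\<le>n. \<forall>y\<le>n. indist D x y \<longrightarrow> (x \<in> A \<longleftrightarrow> y \<in> A))}"
      using D(1) unfolding set_ring_def .
    then show "D = {A. A \<subseteq> {1..n} \<and> (\<forall>x\<in>{0..n}. \<forall>y\<in>{0..n}. indist D x y \<longrightarrow> (x \<in> A \<longleftrightarrow> y \<in> A))}"
      by (simp add: Ball_def)
  qed (use D in auto)
  have "R \<in> T" if R: "R \<in> PRel n" "R \<notin> H_rel n (Pow {1..n})" for R
  proof (rule mem_if_idempotent_power[OF R(1)])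
    fix k D assume D: "set_ring n D" "D \<subseteq> Domain R" "D \<subseteq> Range R"
    have "Domain R \<subseteq> Pow {1..n}" "Range R \<subseteq> Pow {1..n}"
      using set_ring_subset set_ring_Domain[OF R(1)] set_ring_Range[OF R(1)] by blast+
    then have "D \<noteq> Pow {1..n}" using R D by (auto simp: H_rel_def)
    then show "Id_on D \<in> T" using rings D(1) by blast
  qed
  then have "PRel n - H_rel n (Pow {1..n}) \<subseteq> T" by blast
  then show ?thesis using H_rel_cases[of "Pow {1..n}"] sub by blast
qed

text \<open>The argument of \<open>zero_case\<close> carried out inside \<open>Y\<close>: the single
  class is now \<open>Y\<close> and stays apart from 0, which is why \<open>all\<close> must keep
  \<open>T\<close> inside \<open>M_rel n Y\<close>.\<close>

lemma block_case:
  assumes T: "Id_on {{}, Y} \<in> T" and Y: "Y \<subseteq> {1..n}"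
    and all: "\<And>D. Id_on D \<in> T \<Longrightarrow> \<Union>D = Y"
  shows "T = M_rel n Y \<or> T = M_rel n Y - H_rel n (Pow Y)"
proof -
  have "block_ring Y Y = {{}, Y}" unfolding block_ring_def by blast
  then have "Id_on (block_ring Y Y) \<in> T" using T by simp
  then have blk: "Id_on (block_ring Y {x, y}) \<in> T" if "x \<in> Y" "y \<in> Y" "x \<noteq> y" for x y
    using block_rings[OF Y _ _ \<open>Id_on (block_ring Y Y) \<in> T\<close>, of "{x, y}" x y] that Y
    by force
  have rings: "Id_on D \<in> T" if D: "set_ring n D" "Y \<in> D" "D \<subseteq> Pow Y" "D \<noteq> Pow Y" for D
  proof (rule mem_if_pairs[OF blk])
    show "D = {A. A \<subseteq> Y \<and> (\<forall>x\<in>Y. \<forall>y\<in>Y. indist D x y \<longrightarrow> (x \<in> A \<longleftrightarrow> y \<in> A))}"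
    proof (intro equalityI subsetI)
      fix A assume A: "A \<in> {A. A \<subseteq> Y \<and> (\<forall>x\<in>Y. \<forall>y\<in>Y. indist D x y \<longrightarrow> (x \<in> A \<longleftrightarrow> y \<in> A))}"
      show "A \<in> D"
      proof (rule set_ring_memI[OF D(1)])
        show "A \<subseteq> {1..n}" using A Y by blast
        fix x y assume xy: "indist D x y" "x \<in> A"
        then have "x \<in> Y" "y \<in> Y" using A indistD[OF xy(1) D(2)] by blast+
        then show "y \<in> A" using A xy by blast
      qed
    qed (use D(3) in \<open>auto dest: indistD\<close>)
    show "finite Y" using Y finite_subset by blast
  qed (use D in auto)
  have TM: "T \<subseteq> M_rel n Y"
  proof
    fix R assume R: "R \<in> T"
    then have RP: "R \<in> PRel n" using sub by blast
    have "\<Union>(Domain R) = Y" "\<Union>(Range R) = Y" using all Id_Domain[OF R] Id_Range[OF R] by blast+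
    then show "R \<in> M_rel n Y" using PRel_Union[OF RP] RP by (auto simp: M_rel_def)
  qed
  have "R \<in> T" if R: "R \<in> M_rel n Y" "R \<notin> H_rel n (Pow Y)" for R
  proof (rule mem_if_idempotent_power)
    show RP: "R \<in> PRel n" using R by (simp add: M_rel_def)
    fix k D assume D: "R ^^ k = Id_on D" "set_ring n D" "D \<subseteq> Domain R" "D \<subseteq> Range R"
    have RY: "(Y, Y) \<in> R" "Domain R \<subseteq> Pow Y" "Range R \<subseteq> Pow Y" using R by (auto simp: M_rel_def)
    have "Y \<in> D" using relpow_fixed[OF RY(1), of k] D(1) by auto
    moreover have "D \<noteq> Pow Y" using R(2) RP RY D by (auto simp: H_rel_def)
    ultimately show "Id_on D \<in> T" using rings D(2,3) RY(2) by blast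
  qed
  then have "M_rel n Y - H_rel n (Pow Y) \<subseteq> T" by blast
  then show ?thesis using H_rel_cases[of "Pow Y"] TM M_rel_subset_H[OF Y] by blast
qed

lemma classification:
  assumes n: "n \<ge> 3"
  shows "T = PRel n \<or> T = PRel n - H_rel n (Pow {1..n}) \<or>
    (\<exists>Y. (Y = {1..n} \<or> (\<exists>t\<in>{1..n}. Y = {1..n} - {t})) \<and>
      (T = M_rel n Y \<or> T = M_rel n Y - H_rel n (Pow Y) \<or> T = H_rel n (Pow Y) \<or>
       (\<exists>x\<in>Y. \<exists>y\<in>Y. x \<noteq> y \<and> T = H_rel n (block_ring Y {x, y}))))"
proof -
  obtain D0 where D0: "Id_on D0 \<in> T" and least: "\<And>D. Id_on D \<in> T \<Longrightarrow> D0 \<subseteq> D"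
    using least_ring by blast
  note noswap = no_swap[OF D0 least]
  have r0: "set_ring n D0" using ring[OF D0] .
  define Y where "Y = \<Union>D0"
  have Y: "Y \<subseteq> {1..n}" using set_ring_Union_subset[OF r0] by (simp add: Y_def)
  have YD0: "Y \<in> D0" using set_ring_Union[OF r0] by (simp add: Y_def)
  have D0Y: "D0 \<subseteq> Pow Y" by (auto simp: Y_def)
  have out: "indist D0 x 0" if "x \<notin> Y" for x using that indist_zero_iff[OF r0] by (simp add: Y_def)
  show ?thesis
  proof (cases "\<exists>s t. s \<in> {1..n} - Y \<and> t \<in> {1..n} - Y \<and> s \<noteq> t")
    case True
    then obtain s t where st: "s \<in> {1..n}" "t \<in> {1..n}" "s \<notin> Y" "t \<notin> Y" "s \<noteq> t" by blast
    let ?D = "split_off n D0 s"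
    have ts: "indist D0 t s"
      using indist_trans[OF out[OF st(4)] indist_sym[OF out[OF st(3)]]] .
    \<comment> \<open>The root moves \<open>t\<close> from the class of 0 to the new class of
      \<open>s\<close>, and 0 stays behind as the required second element.\<close>
    have "Id_on ?D \<in> T"
    proof (rule split_class)
      show "indist ?D t 0" using split_off_indist[OF out] st by auto
      show "\<not> indist ?D t s" using split_off_sep[of s n t D0] st indist_sym by auto
      show "Id_on {A \<in> ?D. t \<in> A \<longleftrightarrow> s \<in> A} \<in> T"
        using split_off_merge[OF r0, of t s] ts st D0 by auto
    qed (use st set_ring_split_off in auto)
    moreover have "{A \<in> ?D. 0 \<in> A \<longleftrightarrow> s \<in> A} = D0"
      using split_off_merge[OF r0, of 0 s] out[OF st(3)] st indist_sym by auto
    moreover have "\<not> indist ?D s 0" using split_off_sep[of s n 0 D0] st by auto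
    moreover have "\<not> indist ?D 0 s" using calculation(3) indist_sym by blast
    moreover have "s \<le> n" using st by simp
    \<comment> \<open>Minimality is applied with 0 as \<open>u\<close>: any \<open>w\<close> in
      \<open>Y\<close> could change places with \<open>s\<close> and would then be merged with
      0.\<close>
    ultimately have "indist D0 0 w" if "w \<in> Y" for w
      using noswap[of ?D 0 s w] that unfolding Y_def by simp
    then have "Y = {}" using indist_zero_iff[OF r0] indist_sym unfolding Y_def by blast
    then have "D0 = {{}}" using D0Y YD0 by blast
    then have "T = PRel n \<or> T = PRel n - H_rel n (Pow {1..n})"
      using zero_case D0 n by (simp del: One_nat_def)
    then show ?thesis by blast
  next
    case False
    have bigY: "Y = {1..n} \<or> (\<exists>t\<in>{1..n}. Y = {1..n} - {t})"
    proof (cases "Y = {1..n}")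
      case False
      then obtain t where t: "t \<in> {1..n}" "t \<notin> Y" using Y by blast
      then have "Y = {1..n} - {t}"
        using Y \<open>\<not> (\<exists>s t. s \<in> {1..n} - Y \<and> t \<in> {1..n} - Y \<and> s \<noteq> t)\<close> by blast
      then show ?thesis using t by blast
    qed simp
    have "1 \<in> Y \<or> 2 \<in> Y" using bigY n by auto
    then have Yne: "Y \<noteq> {}" by blast
    \<comment> \<open>If a ring of \<open>T\<close> covered some \<open>t\<close> outside
      \<open>Y\<close>, the class of \<open>t\<close> could be interchanged with that of some
      \<open>w\<close> in \<open>Y\<close>. The conjugate of \<open>D0\<close> would have no member
      containing \<open>w\<close>, yet by minimality it contains \<open>Y\<close>.\<close>
    have all: "\<Union>D = Y" if D: "Id_on D \<in> T" for D
    proof (rule ccontr)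
      assume "\<Union>D \<noteq> Y"
      moreover have "Y \<subseteq> \<Union>D" "\<Union>D \<subseteq> {1..n}"
        using least[OF D] set_ring_Union_subset[OF ring[OF D]] by (auto simp: Y_def)
      ultimately obtain t where t: "t \<in> {1..n}" "t \<notin> Y" "t \<in> \<Union>D" by blast
      obtain w where w: "w \<in> Y" using Yne by blast
      have "\<not> indist D t w" using indist_mono[OF _ least[OF D]] indistD[OF _ YD0] w t by blast
      moreover have "\<not> indist D t 0" using indist_zero_iff[OF ring[OF D]] t by blast
      moreover have "\<not> indist D w 0"
        using indist_zero_iff[OF ring[OF D]] w \<open>Y \<subseteq> \<Union>D\<close> by blast
      moreover have "t \<le> n" "w \<le> n" using t w Y by auto
      ultimately obtain E' where E': "Id_on E' \<in> T"
        "\<And>B. B \<in> E' \<Longrightarrow> \<exists>A\<in>D0. (t \<in> A \<longleftrightarrow> w \<in> B) \<and> (w \<in> A \<longleftrightarrow> t \<in> B) \<and>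
         (\<forall>u\<le>n. \<not> indist D u t \<longrightarrow> \<not> indist D u w \<longrightarrow> (u \<in> A \<longleftrightarrow> u \<in> B))"
        using swap[OF D D0 least[OF D]] by blast
      then obtain A where "A \<in> D0" "t \<in> A" using least[OF E'(1)] YD0 w by blast
      then show False using t(2) by (auto simp: Y_def)
    qed
    have TDR: "D0 \<subseteq> Domain R \<and> Domain R \<subseteq> Pow Y \<and> D0 \<subseteq> Range R \<and> Range R \<subseteq> Pow Y"
      if R: "R \<in> T" for R
      using all[OF Id_Domain[OF R]] all[OF Id_Range[OF R]] least[OF Id_Domain[OF R]]
        least[OF Id_Range[OF R]] by blast
    have "T = M_rel n Y \<or> T = M_rel n Y - H_rel n (Pow Y) \<or> T = H_rel n (Pow Y) \<or>
       (\<exists>x\<in>Y. \<exists>y\<in>Y. x \<noteq> y \<and> T = H_rel n (block_ring Y {x, y}))"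
    proof (cases "D0 = {{}, Y} \<or> D0 = Pow Y")
      case True
      then consider "D0 = {{}, Y}" | "D0 = Pow Y" by blast
      then show ?thesis
      proof cases
        case 1
        then show ?thesis using block_case[OF _ Y all] D0 by blast
      next
        case 2
        have "R \<in> H_rel n (Pow Y)" if "R \<in> T" for R
          using TDR[OF that] 2 that sub by (auto simp: H_rel_def)
        then show ?thesis using H_rel_subset[OF D0] 2 by blast
      qed
    next
      case False
      have notall: "\<exists>w\<in>Y. \<not> indist D0 u w" if "u \<in> Y" for u
      proof (rule ccontr)
        assume "\<not> (\<exists>w\<in>Y. \<not> indist D0 u w)"
        then have u: "indist D0 u w" if "w \<in> Y" for w using that by blast
        have "A = {} \<or> A = Y" if A: "A \<in> D0" for A
          using indistD[OF u A] D0Y A by blast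
        then have "D0 = {{}, Y}" using YD0 set_ring_empty[OF r0] by blast
        then show False using False by blast
      qed
      have inY: "y \<in> Y" if "indist D0 x y" "x \<in> Y" for x y using indistD[OF that(1) YD0] that(2) by simp
      have nz: "\<not> indist D0 x 0" if "x \<in> Y" for x using inY[of x 0] that Y by auto
      have le: "x \<le> n" "1 \<le> x" if "x \<in> Y" for x using that Y by auto
      have "\<exists>x\<in>Y. \<exists>x'\<in>Y. x \<noteq> x' \<and> indist D0 x x'"
        using ex_indist_pair[OF r0 YD0 D0Y] False by blast
      then obtain x x' where x: "x \<in> Y" "x' \<in> Y" "x \<noteq> x'" "indist D0 x x'" by blast
      \<comment> \<open>In a class of three elements, \<open>x3\<close> can be split off while
        \<open>x1\<close> and \<open>x2\<close> remain together; minimality then puts all of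
        \<open>Y\<close> into one class.\<close>
      have three: False if "x1 \<in> Y" "x2 \<in> Y" "x3 \<in> Y" "x1 \<noteq> x2" "x1 \<noteq> x3" "x2 \<noteq> x3"
        "indist D0 x1 x2" "indist D0 x1 x3" for x1 x2 x3
      proof -
        let ?D = "split_off n D0 x3"
        have m: "{A \<in> ?D. x1 \<in> A \<longleftrightarrow> x3 \<in> A} = D0"
          using split_off_merge[OF r0, of x1 x3] that le by auto
        have s: "\<not> indist ?D x1 x3" "\<not> indist ?D x3 0"
          using split_off_sep[of x3 n x1 D0] split_off_sep[of x3 n 0 D0] that le[OF that(3)] indist_sym
          by auto
        have "Id_on ?D \<in> T"
        proof (rule split_class)
          show "indist ?D x1 x2" using split_off_indist that le by simp
          show "Id_on {A \<in> ?D. x1 \<in> A \<longleftrightarrow> x3 \<in> A} \<in> T" using m D0 by simp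
          show "x1 \<noteq> 0" using le(2)[OF that(1)] by simp
        qed (use that s le set_ring_split_off in auto)
        then have "indist D0 x1 w" if "w \<in> Y" for w
          using noswap[of ?D x1 x3 w] m s le that \<open>x1 \<in> Y\<close> \<open>x3 \<in> Y\<close> unfolding Y_def by simp
        then show False using notall[OF that(1)] by blast
      qed
      \<comment> \<open>A second nontrivial class is split with the help of the pair
        \<open>x\<close>, \<open>x'\<close>, and the same contradiction follows. Hence exactly one
        pair is merged.\<close>
      have two: False if z: "z \<in> Y" "z' \<in> Y" "z \<noteq> z'" "indist D0 z z'" "\<not> indist D0 x z" for z z'
      proof -
        let ?D = "split_off n D0 z'"
        have m: "{A \<in> ?D. z \<in> A \<longleftrightarrow> z' \<in> A} = D0"
          using split_off_merge[OF r0, of z z'] z le by auto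
        have xz': "\<not> indist D0 x z'" using z indist_trans indist_sym by blast
        have mono: "\<not> indist ?D u v" if "\<not> indist D0 u v" for u v
          using that indist_mono[OF _ split_off_subset[OF r0]] by blast
        have s: "\<not> indist ?D z z'"
          using split_off_sep[of z' n z D0] z le[OF z(2)] indist_sym by auto
        have "Id_on ?D \<in> T"
        proof (rule split_pair)
          show "indist ?D x x'"
            using split_off_indist[OF x(4), of n z'] x xz' le indist_refl by metis
          show "Id_on {A \<in> ?D. z \<in> A \<longleftrightarrow> z' \<in> A} \<in> T" using m D0 by simp
        qed (use x z s le set_ring_split_off mono nz xz' in auto)
        then have "indist D0 z w" if "w \<in> Y" for w
          using noswap[of ?D z z' w] m s le that z mono[OF nz[OF z(2)]] unfolding Y_def by simp
        then show False using notall[OF z(1)] by blast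
      qed
      have D0eq: "D0 = block_ring Y {x, x'}"
      proof (intro equalityI subsetI)
        fix A assume "A \<in> D0"
        then show "A \<in> block_ring Y {x, x'}" using D0Y indistD[OF x(4)] by (auto simp: block_ring_pair)
      next
        fix A assume A: "A \<in> block_ring Y {x, x'}"
        show "A \<in> D0"
        proof (rule set_ring_memI[OF r0])
          show "A \<subseteq> {1..n}" using A Y by (auto simp: block_ring_pair)
          fix z z' assume z: "indist D0 z z'" "z \<in> A"
          have zY: "z \<in> Y" using A z by (auto simp: block_ring_pair)
          then have z'Y: "z' \<in> Y" using inY z by blast
          show "z' \<in> A"
          proof (cases "z = z'")
            case False
            then have xz: "indist D0 x z" using two[OF zY z'Y False z(1)] by blast
            then have xz': "indist D0 x z'" using z(1) indist_trans by blast
            have "z \<in> {x, x'}" "z' \<in> {x, x'}"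
              using three[OF x(1,2) zY x(3) _ _ x(4) xz] three[OF x(1,2) z'Y x(3) _ _ x(4) xz'] by blast+
            then show ?thesis using A z(2) by (auto simp: block_ring_pair)
          qed (use z in simp)
        qed
      qed
      \<comment> \<open>With the top ring in \<open>T\<close>, the merged pair could be moved around
        inside \<open>Y\<close>, against minimality. By \<open>ring_between\<close> no other ring is
        left above \<open>D0\<close>.\<close>
      have noPow: "Id_on (Pow Y) \<notin> T"
      proof
        assume P: "Id_on (Pow Y) \<in> T"
        have "D0 = {A \<in> Pow Y. x \<in> A \<longleftrightarrow> x' \<in> A}" using D0eq by (auto simp: block_ring_pair)
        moreover have "\<not> indist (Pow Y) x x'" using x indistD[of "Pow Y" x x' "{x}"] by auto
        moreover have "\<not> indist (Pow Y) x' 0"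
          using x(2) indistD[of "Pow Y" x' 0 "{x'}"] le(2)[OF x(2)] by auto
        ultimately have "indist D0 x w" if "w \<in> Y" for w
          using noswap[of "Pow Y" x x' w] P x le that unfolding Y_def by simp
        then show False using notall[OF x(1)] by blast
      qed
      have "T \<subseteq> H_rel n D0"
      proof
        fix R assume R: "R \<in> T"
        then have RP: "R \<in> PRel n" using sub by blast
        have "Domain R \<noteq> Pow Y" "Range R \<noteq> Pow Y" using noPow Id_Domain[OF R] Id_Range[OF R] by auto
        then have "Domain R = D0" "Range R = D0"
          using ring_between[OF set_ring_Domain[OF RP] Y x(1,2)]
            ring_between[OF set_ring_Range[OF RP] Y x(1,2)] TDR[OF R] D0eq by simp_all
        then show "R \<in> H_rel n D0" using RP by (simp add: H_rel_def)
      qed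
      then have "T = H_rel n (block_ring Y {x, x'})" using H_rel_subset[OF D0] D0eq by blast
      then show ?thesis using x by blast
    qed
    then show ?thesis using bigY by blast
  qed
qed

end

section \<open>The listed families are isolated\<close>

lemma H_relD:
  assumes "R \<in> H_rel n D"
  shows "R \<in> PRel n" "Domain R = D" "Range R = D"
  using assms by (simp_all add: H_rel_def)

lemma M_relD:
  assumes "R \<in> M_rel n Y"
  shows "R \<in> PRel n" "(Y, Y) \<in> R" "Domain R \<subseteq> Pow Y" "Range R \<subseteq> Pow Y"
  using assms by (simp_all add: M_rel_def)

lemma H_rel_comp:
  assumes "R \<in> H_rel n D" "S \<in> H_rel n D"
  shows "R O S \<in> H_rel n D"
proof -
  have "Domain (R O S) = Domain R" "Range (R O S) = Range S"
    using H_relD(2,3)[OF assms(1)] H_relD(2,3)[OF assms(2)] by (blast, blast)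
  then show ?thesis using assms PRel_comp by (simp add: H_rel_def)
qed

lemma H_rel_relpow: "R \<in> H_rel n D \<Longrightarrow> k \<ge> 1 \<Longrightarrow> R ^^ k \<in> H_rel n D"
  using Domain_relpow_eq[of R D k] PRel_relpow[of R n k] by (simp add: H_rel_def)

lemma Id_on_H_rel: "set_ring n D \<Longrightarrow> Id_on D \<in> H_rel n D"
  by (simp add: H_rel_def Id_on_PRel)

lemma M_rel_comp:
  assumes "R \<in> M_rel n Y" "S \<in> M_rel n Y"
  shows "R O S \<in> M_rel n Y"
proof -
  note R = M_relD[OF assms(1)] and S = M_relD[OF assms(2)]
  have "Domain (R O S) \<subseteq> Pow Y" "Range (R O S) \<subseteq> Pow Y" using R(3) S(4) by (blast, blast)
  then show ?thesis using PRel_comp[OF R(1) S(1)] R(2) S(2) by (auto simp: M_rel_def)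
qed

text \<open>The unions \<open>M\<close> and \<open>N\<close> of domain and range contain
  \<open>Y\<close>, and with at most one element missing each is \<open>Y\<close> or {1..n}. If both
  are {1..n}, every power relates {1..n} to itself. If just one is, \<open>Y\<close> and {1..n} are
  partners under \<open>R\<close>, and the chain of \<open>R\<close>-steps that makes up the
  \<open>k\<close>-th power cannot both start and end at \<open>Y\<close>.\<close>

lemma M_rel_root:
  assumes Y: "Y = {1..n} \<or> (\<exists>t\<in>{1..n}. Y = {1..n} - {t})"
    and R: "R \<in> PRel n" and k: "k \<ge> 1" and Rk: "R ^^ k \<in> M_rel n Y"
  shows "R \<in> M_rel n Y"
proof -
  define M where "M = \<Union>(Domain R)"
  define N where "N = \<Union>(Range R)"
  have MN: "(M, N) \<in> R" using PRel_Union[OF R] by (simp add: M_def N_def)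
  note P = M_relD[OF Rk]
  have "Y \<in> Domain R" "Y \<in> Range R" using relpow_subset[OF k, of R] P(2) by blast+
  then have sub: "Y \<subseteq> M" "Y \<subseteq> N" by (auto simp: M_def N_def)
  have X: "M \<subseteq> {1..n}" "N \<subseteq> {1..n}"
    unfolding M_def N_def using set_ring_Union_subset set_ring_Domain[OF R] set_ring_Range[OF R] by blast+
  have choice: "Z = Y \<or> Z = {1..n} \<and> Y \<noteq> {1..n}" if "Y \<subseteq> Z" "Z \<subseteq> {1..n}" for Z
    using that Y by blast
  obtain j where j: "k = Suc j" using k by (cases k) auto
  have jk: "R ^^ k = R O R ^^ j" "R ^^ k = R ^^ j O R" using relpow_commute[of R j] j by simp_all
  have inner: "j = 0 \<or> Domain (R ^^ j) \<subseteq> Domain R \<and> Range (R ^^ j) \<subseteq> Range R"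
    using relpow_subset[of j R] by (cases "j = 0") auto
  have dom: "Domain R \<subseteq> Pow M" "Range R \<subseteq> Pow N" by (auto simp: M_def N_def)
  have "M = Y \<and> N = Y"
  proof (rule ccontr)
    assume not: "\<not> (M = Y \<and> N = Y)"
    then have ne: "Y \<noteq> {1..n}" and c: "M = Y \<or> M = {1..n}" "N = Y \<or> N = {1..n}"
      using choice sub X by blast+
    then have nsub: "\<not> {1..n} \<subseteq> Y" using sub X by blast
    consider "M = {1..n}" "N = {1..n}" | "M = {1..n}" "N = Y" | "M = Y" "N = {1..n}"
      using c not by blast
    then show False
    proof cases
      case 1
      then have "({1..n}, {1..n}) \<in> R ^^ k" using relpow_fixed[OF MN[unfolded 1]] by simp
      then show ?thesis using P(3) nsub by blast
    next
      case 2
      obtain A where A: "(Y, A) \<in> R ^^ j" "(A, Y) \<in> R" using P(2) jk(2) by blast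
      then have "A = {1..n}" using MN 2 PRel_injective[OF R] by blast
      moreover have "A = Y \<or> A \<subseteq> N"
      proof (cases "j = 0")
        case False
        then have "A \<in> Range R" using inner A(1) by blast
        then show ?thesis using dom by blast
      qed (use A(1) in simp)
      ultimately show ?thesis using 2 nsub by blast
    next
      case 3
      obtain A where A: "(Y, A) \<in> R" "(A, Y) \<in> R ^^ j" using P(2) jk(1) by blast
      then have "A = {1..n}" using MN 3 PRel_functional[OF R] by blast
      moreover have "A = Y \<or> A \<subseteq> M"
      proof (cases "j = 0")
        case False
        then have "A \<in> Domain R" using inner A(2) by blast
        then show ?thesis using dom by blast
      qed (use A(2) in simp)
      ultimately show ?thesis using 3 nsub by blast
    qed
  qed
  then show ?thesis using R MN dom by (simp add: M_rel_def)
qed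

text \<open>Only the first factor has to be recovered: this already shows that removing the top
  group leaves a set closed under products.\<close>

lemma H_Pow_if_comp:
  assumes "R \<in> PRel n" "Domain R \<subseteq> Pow Y" "Range R \<subseteq> Pow Y" "R O S \<in> H_rel n (Pow Y)"
  shows "R \<in> H_rel n (Pow Y)"
proof -
  have "Pow Y \<subseteq> Domain R" using H_relD(2)[OF assms(4)] by blast
  then show ?thesis using H_rel_eq_if_Domain assms by blast
qed

lemma PRel_Domain_Range_subset:
  assumes "R \<in> PRel n"
  shows "Domain R \<subseteq> Pow {1..n}" "Range R \<subseteq> Pow {1..n}"
  using set_ring_subset[OF set_ring_Domain[OF assms]] set_ring_subset[OF set_ring_Range[OF assms]]
  by blast+

lemma H_Pow_root:
  assumes Y: "Y = {1..n} \<or> (\<exists>t\<in>{1..n}. Y = {1..n} - {t})"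
    and R: "R \<in> PRel n" and k: "k \<ge> 1" and Rk: "R ^^ k \<in> H_rel n (Pow Y)"
  shows "R \<in> H_rel n (Pow Y)"
proof -
  have "Y \<subseteq> {1..n}" using Y by blast
  then have "R \<in> M_rel n Y" using M_rel_root[OF Y R k] subsetD[OF M_rel_subset_H Rk] by blast
  moreover have "Pow Y \<subseteq> Domain R" "Pow Y \<subseteq> Range R"
    using relpow_subset[OF k, of R] H_relD(2,3)[OF Rk] by simp_all
  ultimately show ?thesis using M_relD(3,4) R by (simp add: H_rel_def subset_antisym)
qed

text \<open>Domain and range of \<open>R\<close> lie between the ring and \<open>Pow Y\<close>,
  which leaves two possibilities for each. If either were \<open>Pow Y\<close>, counting would place
  \<open>R\<close> and all its powers in the top group.\<close>

lemma H_block_root: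
  assumes Y: "Y = {1..n} \<or> (\<exists>t\<in>{1..n}. Y = {1..n} - {t})" and xy: "x \<in> Y" "y \<in> Y" "x \<noteq> y"
    and R: "R \<in> PRel n" and k: "k \<ge> 1" and Rk: "R ^^ k \<in> H_rel n (block_ring Y {x, y})"
  shows "R \<in> H_rel n (block_ring Y {x, y})"
proof -
  let ?D = "block_ring Y {x, y}"
  note P = H_relD[OF Rk]
  have YX: "Y \<subseteq> {1..n}" using Y by blast
  have D: "Y \<in> ?D" "?D \<subseteq> Pow Y" "?D \<noteq> Pow Y"
    using xy by (auto simp: block_ring_pair set_eq_iff[of ?D])
  then have "\<Union>?D = Y" by blast
  then have "(Y, Y) \<in> R ^^ k" using PRel_Union[OF P(1)] P(2,3) by simp
  then have "R ^^ k \<in> M_rel n Y" using P D(2) by (simp add: M_rel_def)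
  then have RM: "R \<in> M_rel n Y" using M_rel_root[OF Y R k] by blast
  have "Domain R \<noteq> Pow Y"
  proof
    assume "Domain R = Pow Y"
    then have "R \<in> H_rel n (Pow Y)" using H_rel_eq_if_Domain[OF R] M_relD(4)[OF RM] by blast
    then have "Domain (R ^^ k) = Pow Y" using H_rel_relpow[OF _ k] H_relD(2) by blast
    then show False using P(2) D(3) by simp
  qed
  moreover have "Range R \<noteq> Pow Y"
  proof
    assume "Range R = Pow Y"
    then have "R \<in> H_rel n (Pow Y)" using H_rel_eq_if_Range[OF R] M_relD(3)[OF RM] by blast
    then have "Domain (R ^^ k) = Pow Y" using H_rel_relpow[OF _ k] H_relD(2) by blast
    then show False using P(2) D(3) by simp
  qed
  moreover have "?D \<subseteq> Domain R" "?D \<subseteq> Range R" using relpow_subset[OF k, of R] P(2,3) by simp_all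
  ultimately show ?thesis
    using ring_between[OF set_ring_Domain[OF R] YX xy(1,2)] M_relD(3,4)[OF RM]
      ring_between[OF set_ring_Range[OF R] YX xy(1,2)] R by (simp add: H_rel_def)
qed

lemma Id_on_block_M_rel:
  assumes Y: "Y \<subseteq> {1..n}" and xy: "x \<in> Y" "y \<in> Y" "x \<noteq> y"
  shows "Id_on (block_ring Y {x, y}) \<in> M_rel n Y - H_rel n (Pow Y)"
proof -
  have "{x, y} \<subseteq> {0..n}" using xy Y by auto
  then have "Id_on (block_ring Y {x, y}) \<in> PRel n" using Id_on_PRel[OF set_ring_block_ring[OF Y]] by blast
  moreover have "Y \<in> block_ring Y {x, y}" "{x} \<notin> block_ring Y {x, y}" "block_ring Y {x, y} \<subseteq> Pow Y"
    using xy by (auto simp: block_ring_pair)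
  moreover have "{x} \<in> Pow Y" using xy by simp
  ultimately show ?thesis unfolding M_rel_def H_rel_def by auto
qed

theorem isolated_rels_iff:
  assumes n: "n \<ge> 3"
  shows "isolated_rels n T \<longleftrightarrow> T = PRel n \<or> T = PRel n - H_rel n (Pow {1..n}) \<or>
    (\<exists>Y. (Y = {1..n} \<or> (\<exists>t\<in>{1..n}. Y = {1..n} - {t})) \<and>
      (T = M_rel n Y \<or> T = M_rel n Y - H_rel n (Pow Y) \<or> T = H_rel n (Pow Y) \<or>
       (\<exists>x\<in>Y. \<exists>y\<in>Y. x \<noteq> y \<and> T = H_rel n (block_ring Y {x, y}))))" (is "_ \<longleftrightarrow> ?R")
proof
  show "isolated_rels n T \<Longrightarrow> ?R" using isolated_rels.classification n by blast
  assume R: ?R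
  \<comment> \<open>A pair is needed in every admissible \<open>Y\<close>: its ring shows that
    \<open>T\<close> is nonempty after the top group has been removed.\<close>
  have two: "\<exists>x\<in>Y. \<exists>y\<in>Y. x \<noteq> y" if Y: "Y = {1..n} \<or> (\<exists>t\<in>{1..n}. Y = {1..n} - {t})" for Y
  proof -
    have "1 \<in> {1..n}" "2 \<in> {1..n}" "3 \<in> {1..n}" using n by auto
    then have "1 \<in> Y \<and> 2 \<in> Y \<or> 1 \<in> Y \<and> 3 \<in> Y \<or> 2 \<in> Y \<and> 3 \<in> Y" using Y by auto
    moreover have "(1::nat) \<noteq> 2" "(1::nat) \<noteq> 3" "(2::nat) \<noteq> 3" by simp_all
    ultimately show ?thesis by blast
  qed
  from R consider "T = PRel n" | "T = PRel n - H_rel n (Pow {1..n})"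
    | Y where "Y = {1..n} \<or> (\<exists>t\<in>{1..n}. Y = {1..n} - {t})" "T = M_rel n Y"
    | Y where "Y = {1..n} \<or> (\<exists>t\<in>{1..n}. Y = {1..n} - {t})" "T = M_rel n Y - H_rel n (Pow Y)"
    | Y where "Y = {1..n} \<or> (\<exists>t\<in>{1..n}. Y = {1..n} - {t})" "T = H_rel n (Pow Y)"
    | Y x y where "Y = {1..n} \<or> (\<exists>t\<in>{1..n}. Y = {1..n} - {t})" "x \<in> Y" "y \<in> Y" "x \<noteq> y"
        "T = H_rel n (block_ring Y {x, y})"
    by metis
  then show "isolated_rels n T"
  proof cases
    case 1
    show ?thesis
    proof
      show "T \<noteq> {}" using 1 Id_on_PRel[OF set_ring_Pow[OF order_refl]] by blast
    qed (use 1 PRel_comp in auto)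
  next
    case 2
    obtain x y :: nat where xy: "x \<in> {1..n}" "y \<in> {1..n}" "x \<noteq> y" using two by blast
    show ?thesis
    proof
      show "T \<noteq> {}" using Id_on_block_M_rel[OF order_refl xy] M_relD(1) 2 by blast
      show "R O S \<in> T" if "R \<in> T" "S \<in> T" for R S
        using that H_Pow_if_comp[OF _ PRel_Domain_Range_subset] PRel_comp 2 by blast
      show "R \<in> T" if "R \<in> PRel n" "k \<ge> 1" "R ^^ k \<in> T" for R k
        using that H_rel_relpow[OF _ that(2)] 2 by blast
    qed (use 2 in auto)
  next
    case 3
    have Y: "Y \<subseteq> {1..n}" using 3(1) by blast
    obtain x y where xy: "x \<in> Y" "y \<in> Y" "x \<noteq> y" using two[OF 3(1)] by blast
    show ?thesis
    proof
      show "T \<noteq> {}" using Id_on_block_M_rel[OF Y xy] 3(2) by blast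
      show "R \<in> T" if "R \<in> PRel n" "k \<ge> 1" "R ^^ k \<in> T" for R k
        using that M_rel_root[OF 3(1)] 3(2) by blast
    qed (use 3(2) M_rel_comp M_relD(1) in auto)
  next
    case 4
    have Y: "Y \<subseteq> {1..n}" using 4(1) by blast
    obtain x y where xy: "x \<in> Y" "y \<in> Y" "x \<noteq> y" using two[OF 4(1)] by blast
    show ?thesis
    proof
      show "T \<noteq> {}" using Id_on_block_M_rel[OF Y xy] 4(2) by blast
      show "R O S \<in> T" if "R \<in> T" "S \<in> T" for R S
        using that H_Pow_if_comp[of R n Y S] M_relD[of R n Y] M_rel_comp 4(2) by blast
      show "R \<in> T" if "R \<in> PRel n" "k \<ge> 1" "R ^^ k \<in> T" for R k
        using that H_rel_relpow[OF _ that(2)] M_rel_root[OF 4(1)] 4(2) by blast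
    qed (use 4(2) M_relD(1) in auto)
  next
    case 5
    have Y: "Y \<subseteq> {1..n}" using 5(1) by blast
    show ?thesis
    proof
      show "T \<noteq> {}" using Id_on_H_rel[OF set_ring_Pow[OF Y]] 5(2) by blast
      show "R \<in> T" if "R \<in> PRel n" "k \<ge> 1" "R ^^ k \<in> T" for R k
        using that H_Pow_root[OF 5(1)] 5(2) by blast
    qed (use 5(2) H_rel_comp H_relD(1) in auto)
  next
    case 6
    have Y: "Y \<subseteq> {1..n}" "{x, y} \<subseteq> {0..n}" using 6(1-3) by auto
    show ?thesis
    proof
      show "T \<noteq> {}" using Id_on_H_rel[OF set_ring_block_ring[OF Y]] 6(5) by blast
      show "R \<in> T" if "R \<in> PRel n" "k \<ge> 1" "R ^^ k \<in> T" for R k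
        using that H_block_root[OF 6(1-4)] 6(5) by blast
    qed (use 6(5) H_rel_comp H_relD(1) in auto)
  qed
qed

section \<open>Transfer to partitions\<close>

definition elems_of :: "nat \<Rightarrow> (nat set \<times> nat set) set set \<Rightarrow> (nat + nat) set set set" where
  "elems_of n S = {a \<in> PIstar n. line_rel a \<in> S}"

lemma line_rel_inj: "a \<in> PIstar n \<Longrightarrow> b \<in> PIstar n \<Longrightarrow> line_rel a = line_rel b \<longleftrightarrow> a = b"
  using inj_on_line_rel[of n] by (auto dest: inj_onD)

lemma ex_elem: "R \<in> PRel n \<Longrightarrow> \<exists>a\<in>PIstar n. line_rel a = R"
  by (auto simp: PRel_eq)

lemma line_rel_PRel: "a \<in> PIstar n \<Longrightarrow> line_rel a \<in> PRel n"
  by (simp add: PRel_eq)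

lemma line_rel_spow:
  assumes a: "a \<in> PIstar n" and k: "k \<ge> 1"
  shows "spow n a k \<in> PIstar n \<and> line_rel (spow n a k) = line_rel a ^^ k"
proof -
  have "((\<lambda>x. star n x a) ^^ j) a \<in> PIstar n \<and> line_rel (((\<lambda>x. star n x a) ^^ j) a) = line_rel a ^^ Suc j" for j
    by (induction j) (simp_all add: a star_in_PIstar line_rel_star)
  then show ?thesis using k by (cases k) (simp_all add: spow_def)
qed

lemma isolated_subsemigroup_iff:
  "isolated_subsemigroup n T \<longleftrightarrow> (\<exists>S. isolated_rels n S \<and> T = elems_of n S)"
proof
  assume T: "isolated_subsemigroup n T"
  then have sub: "T \<subseteq> PIstar n" by (simp add: isolated_subsemigroup_def)
  have mem: "line_rel a \<in> line_rel ` T \<longleftrightarrow> a \<in> T" if "a \<in> PIstar n" for a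
    using inj_on_image_mem_iff[OF inj_on_line_rel that sub] .
  have "isolated_rels n (line_rel ` T)"
  proof
    show "line_rel ` T \<noteq> {}" "line_rel ` T \<subseteq> PRel n"
      using T by (auto simp: isolated_subsemigroup_def PRel_eq)
  next
    fix R S assume "R \<in> line_rel ` T" "S \<in> line_rel ` T"
    then obtain a b where ab: "a \<in> T" "b \<in> T" "R = line_rel a" "S = line_rel b" by blast
    then have "star n a b \<in> T" using T by (simp add: isolated_subsemigroup_def)
    then show "R O S \<in> line_rel ` T" using line_rel_star ab sub by blast
  next
    fix R k assume R: "R \<in> PRel n" "(1::nat) \<le> k" "R ^^ k \<in> line_rel ` T"
    then obtain a where a: "a \<in> PIstar n" "line_rel a = R" using ex_elem by blast
    then have "spow n a k \<in> T" using R(3) line_rel_spow[OF a(1) R(2)] mem[of "spow n a k"] by simp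
    then have "a \<in> T" using T a(1) R(2) by (simp add: isolated_subsemigroup_def)
    then show "R \<in> line_rel ` T" using a by blast
  qed
  moreover have "T = elems_of n (line_rel ` T)" using mem sub by (auto simp: elems_of_def)
  ultimately show "\<exists>S. isolated_rels n S \<and> T = elems_of n S" by blast
next
  assume "\<exists>S. isolated_rels n S \<and> T = elems_of n S"
  then obtain S where S: "isolated_rels n S" and T: "T = elems_of n S" by blast
  interpret isolated_rels n S by (rule S)
  show "isolated_subsemigroup n T"
    unfolding isolated_subsemigroup_def T
  proof (intro conjI ballI allI impI)
    obtain R where "R \<in> S" using ne by blast
    then show "elems_of n S \<noteq> {}" using ex_elem[of R n] sub by (auto simp: elems_of_def)
    show "elems_of n S \<subseteq> PIstar n" by (auto simp: elems_of_def)
  next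
    fix a b assume "a \<in> elems_of n S" "b \<in> elems_of n S"
    then show "star n a b \<in> elems_of n S"
      using star_in_PIstar line_rel_star comp by (simp add: elems_of_def)
  next
    fix a k assume a: "a \<in> PIstar n" "(1::nat) \<le> k" "spow n a k \<in> elems_of n S"
    then have "line_rel a ^^ k \<in> S" using line_rel_spow[OF a(1,2)] by (simp add: elems_of_def)
    then show "a \<in> elems_of n S" using root[OF line_rel_PRel[OF a(1)] a(2)] a(1) by (simp add: elems_of_def)
  qed
qed

section \<open>The candidates as sets of partitions\<close>

lemma elems_of_Diff: "elems_of n (S - S') = elems_of n S - elems_of n S'"
  by (auto simp: elems_of_def)

lemma elems_of_PRel: "elems_of n (PRel n) = PIstar n"
  by (auto simp: elems_of_def line_rel_PRel)

lemma carrier_Inl_Inr: "Inl ` {1..n} \<union> Inr ` {1..n} = carrier n"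
  by (simp add: carrier_def)

lemma elems_of_M_rel_full: "elems_of n (M_rel n {1..n}) = Istar n"
proof -
  have "line_rel a \<in> M_rel n {1..n} \<longleftrightarrow> (\<forall>B\<in>a. is_gline B)" if a: "a \<in> PIstar n" for a
  proof -
    have "line_rel a \<in> M_rel n {1..n} \<longleftrightarrow> ({1..n}, {1..n}) \<in> line_rel a"
      using PRel_Domain_Range_subset[OF line_rel_PRel[OF a]] line_rel_PRel[OF a] by (simp add: M_rel_def)
    also have "\<dots> \<longleftrightarrow> (\<forall>K\<in>a. K \<subseteq> carrier n \<and> is_gline K \<or> K \<inter> carrier n = {})"
      unfolding line_rel_iff[OF a] carrier_Inl_Inr by simp
    also have "\<dots> \<longleftrightarrow> (\<forall>B\<in>a. is_gline B)"
    proof (rule ball_cong[OF refl])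
      fix K assume "K \<in> a"
      then have "K \<subseteq> carrier n" "K \<noteq> {}"
        using PIstar_block_subset[OF a] PIstar_block_nonempty[OF a] by blast+
      then show "K \<subseteq> carrier n \<and> is_gline K \<or> K \<inter> carrier n = {} \<longleftrightarrow> is_gline K" by blast
    qed
    finally show ?thesis .
  qed
  then show ?thesis by (auto simp: elems_of_def Istar_def)
qed

lemma line_rel_singleton:
  assumes a: "a \<in> PIstar n" and AB: "(A, B) \<in> line_rel a" and u: "{u} \<in> a"
  shows "u \<notin> Inl ` A \<union> Inr ` B"
proof -
  have "\<not> is_gline {u}" using point_not_gline by (auto simp: is_point_def)
  then show ?thesis using AB u unfolding line_rel_iff[OF a] by blast
qed

lemma elems_of_M_rel_minus:
  assumes t: "t \<in> {1..n}"
  shows "elems_of n (M_rel n ({1..n} - {t})) = IY n t"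
proof -
  let ?Y = "{1..n} - {t}"
  define D :: "(nat + nat) set" where "D = Inl ` ?Y \<union> Inr ` ?Y"
  have D: "D = carrier n - {Inl t, Inr t}" by (auto simp: D_def carrier_def)
  have "line_rel a \<in> M_rel n ?Y \<longleftrightarrow> {Inl t} \<in> a \<and> {Inr t} \<in> a \<and>
      (\<forall>B\<in>a. B \<noteq> {Inl t} \<and> B \<noteq> {Inr t} \<longrightarrow> is_gline B)" (is "_ \<longleftrightarrow> ?R")
    if a: "a \<in> PIstar n" for a
  proof
    assume M: "line_rel a \<in> M_rel n ?Y"
    have blocks: "K \<subseteq> D \<and> is_gline K \<or> K \<inter> D = {}" if "K \<in> a" for K
      using M_relD(2)[OF M] that unfolding line_rel_iff[OF a] D_def[symmetric] by blast
    have *: "K = {Inl t} \<or> K = {Inr t}" if K: "K \<in> a" "K \<inter> D = {}" for K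
    proof -
      have "K \<subseteq> {Inl t, Inr t}" using K(2) PIstar_block_subset[OF a K(1)] unfolding D by blast
      moreover have "K \<noteq> {}" using PIstar_block_nonempty[OF a K(1)] .
      \<comment> \<open>Such a block would be a line and would put a set containing \<open>t\<close>
        into the domain.\<close>
      moreover have "K \<noteq> {Inl t, Inr t}"
      proof
        assume "K = {Inl t, Inr t}"
        then have "K \<in> lines a" "t \<in> Inl -` K" using K(1) by (auto simp: lines_def is_gline_def)
        then show False using DomainI[OF line_rel_line[of K a]] M_relD(3)[OF M] by blast
      qed
      ultimately show ?thesis by blast
    qed
    have "{u} \<in> a" if u: "u = Inl t \<or> u = Inr t" for u
    proof -
      obtain K where K: "K \<in> a" "u \<in> K" using PIstar_block_exists[OF a, of u] u t by auto
      then have "K \<inter> D = {}" using blocks[OF K(1)] K(2) u unfolding D by blast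
      then show ?thesis using *[OF K(1)] K u by auto
    qed
    moreover have "is_gline B" if "B \<in> a" "B \<noteq> {Inl t}" "B \<noteq> {Inr t}" for B
      using blocks[OF that(1)] *[OF that(1)] that(2,3) by blast
    ultimately show ?R by blast
  next
    assume R: ?R
    have "(?Y, ?Y) \<in> line_rel a"
      unfolding line_rel_iff[OF a] D_def[symmetric]
    proof (intro conjI ballI)
      fix K assume K: "K \<in> a"
      show "K \<subseteq> D \<and> is_gline K \<or> K \<inter> D = {}"
      proof (cases "K = {Inl t} \<or> K = {Inr t}")
        case True
        then show ?thesis unfolding D by auto
      next
        case False
        then have "is_gline K" using R K by blast
        moreover have "Inl t \<notin> K" "Inr t \<notin> K"
          using PIstar_disjoint[OF a K, of "{Inl t}" "Inl t"] PIstar_disjoint[OF a K, of "{Inr t}" "Inr t"]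
            R False by auto
        ultimately show ?thesis using PIstar_block_subset[OF a K] unfolding D by blast
      qed
    qed auto
    moreover have "A \<subseteq> ?Y \<and> B \<subseteq> ?Y" if AB: "(A, B) \<in> line_rel a" for A B
    proof -
      have "t \<notin> A" "t \<notin> B"
        using line_rel_singleton[OF a AB, of "Inl t"] line_rel_singleton[OF a AB, of "Inr t"] R by auto
      moreover have "A \<subseteq> {1..n} \<and> B \<subseteq> {1..n}"
        using AB unfolding line_rel_iff[OF a] by (elim conjE) (intro conjI)
      ultimately show ?thesis by blast
    qed
    ultimately show "line_rel a \<in> M_rel n ?Y"
      using line_rel_PRel[OF a] unfolding M_rel_def by blast
  qed
  then show ?thesis by (auto simp: elems_of_def IY_def)
qed

text \<open>A common form for the elements of \<open>Sn\<close> and \<open>SY\<close>, obtained from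
  \<open>Y\<close> equal to {1..n} and from \<open>Y\<close> with one element missing.\<close>

definition perm_elem :: "nat \<Rightarrow> nat set \<Rightarrow> (nat \<Rightarrow> nat) \<Rightarrow> (nat + nat) set set" where
  "perm_elem n Y \<pi> = (\<lambda>y. {Inl y, Inr (\<pi> y)}) ` Y \<union> (\<lambda>u. {u}) ` (Inl ` ({1..n} - Y) \<union> Inr ` ({1..n} - Y))"

lemma lines_perm_elem: "lines (perm_elem n Y \<pi>) = (\<lambda>y. {Inl y, Inr (\<pi> y)}) ` Y"
proof -
  have "is_gline {Inl y, Inr z}" for y z by (simp add: is_gline_def)
  moreover have "\<not> is_gline {u}" for u by (rule point_not_gline) (simp add: is_point_def)
  ultimately show ?thesis unfolding lines_def perm_elem_def by auto
qed

lemma line_rel_perm_elem: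
  assumes "perm_elem n Y \<pi> \<in> PIstar n" "\<pi> permutes Y"
  shows "line_rel (perm_elem n Y \<pi>) \<in> H_rel n (Pow Y)"
proof (rule H_rel_eq_if_Domain)
  let ?f = "\<lambda>y. {Inl y, Inr (\<pi> y)} :: (nat + nat) set"
  have in_Y: "\<pi> y \<in> Y \<longleftrightarrow> y \<in> Y" for y using permutes_in_image[OF assms(2)] .
  have rel: "line_rel (perm_elem n Y \<pi>) = (\<lambda>A. (A, \<pi> ` A)) ` Pow Y"
  proof -
    have "(Inl -` \<Union>(?f ` A), Inr -` \<Union>(?f ` A)) = (A, \<pi> ` A)" for A by auto
    then show ?thesis
      unfolding line_rel_def lines_perm_elem image_Pow_surj[OF refl, symmetric] image_image by simp
  qed
  show "Domain (line_rel (perm_elem n Y \<pi>)) = Pow Y" unfolding rel by force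
  show "Range (line_rel (perm_elem n Y \<pi>)) \<subseteq> Pow Y" unfolding rel using in_Y by auto
qed (rule line_rel_PRel[OF assms(1)])

text \<open>All singletons of \<open>Y\<close> occur in both domain and range, so the line through
  \<open>x\<close> is confined to one element on each side. This defines the permutation.\<close>

lemma perm_elem_if_H_rel:
  assumes a: "a \<in> PIstar n" and Y: "Y \<subseteq> {1..n}" and H: "line_rel a \<in> H_rel n (Pow Y)"
  shows "\<exists>\<pi>. \<pi> permutes Y \<and> a = perm_elem n Y \<pi>"
proof -
  have L: "\<exists>y\<in>Y. {Inl x, Inr y} \<in> lines a" if x: "x \<in> Y" for x
  proof -
    have "\<exists>B. ({x}, B) \<in> line_rel a" using H_relD(2)[OF H] x by blast
    then obtain B where "({x}, B) \<in> line_rel a" by blast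
    note B = this[unfolded line_rel_iff[OF a]]
    have "Inl x \<in> carrier n" using x Y by auto
    then obtain K where K: "K \<in> a" "Inl x \<in> K" using PIstar_block_exists[OF a] by blast
    have KB: "K \<subseteq> Inl ` {x} \<union> Inr ` B" "is_gline K" using B K by blast+
    then obtain y where y: "Inr y \<in> K" by (auto simp: is_gline_def)
    have Kl: "K \<in> lines a" using K KB by (simp add: lines_def)
    have "Inr -` K \<in> Pow Y" using RangeI[OF line_rel_line[OF Kl]] unfolding H_relD(3)[OF H] .
    then have yY: "y \<in> Y" using y by blast
    then have "\<exists>A. (A, {y}) \<in> line_rel a" using H_relD(3)[OF H] by blast
    then obtain A where "(A, {y}) \<in> line_rel a" by blast
    note A = this[unfolded line_rel_iff[OF a]]
    have "K \<subseteq> Inl ` A \<union> Inr ` {y}" using A K y by blast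
    then have "K = {Inl x, Inr y}" using KB(1) K(2) y by blast
    then show ?thesis using Kl yY by blast
  qed
  then obtain f where f: "\<And>x. x \<in> Y \<Longrightarrow> f x \<in> Y \<and> {Inl x, Inr (f x)} \<in> lines a" by metis
  define \<pi> where "\<pi> x = (if x \<in> Y then f x else x)" for x
  have la: "lines a \<subseteq> a" by (auto simp: lines_def)
  have inj: "inj_on \<pi> Y"
  proof (rule inj_onI)
    fix x x' assume x: "x \<in> Y" "x' \<in> Y" "\<pi> x = \<pi> x'"
    then have "f x = f x'" by (simp add: \<pi>_def)
    moreover have "{Inl x, Inr (f x)} \<in> a" "{Inl x', Inr (f x')} \<in> a" using f x la by blast+
    ultimately have "{Inl x, Inr (f x)} = ({Inl x', Inr (f x')} :: (nat + nat) set)"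
      by (intro PIstar_disjoint[OF a, of _ _ "Inr (f x)"]) auto
    then show "x = x'" by (simp add: doubleton_eq_iff)
  qed
  have "\<pi> ` Y \<subseteq> Y" using f by (auto simp: \<pi>_def)
  then have "bij_betw \<pi> Y Y"
    using inj endo_inj_surj[of Y \<pi>] finite_subset[OF Y] by (simp add: bij_betw_def)
  then have perm: "\<pi> permutes Y" by (rule bij_imp_permutes) (simp add: \<pi>_def)
  have lines: "lines a = (\<lambda>y. {Inl y, Inr (\<pi> y)}) ` Y"
  proof (intro equalityI subsetI)
    fix K assume K: "K \<in> lines a"
    then obtain x where x: "Inl x \<in> K" by (auto simp: lines_def is_gline_def)
    have "Inl -` K \<in> Pow Y" using DomainI[OF line_rel_line[OF K]] unfolding H_relD(2)[OF H] .
    then have "x \<in> Y" using x by blast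
    moreover have "K = {Inl x, Inr (f x)}"
      using f[OF \<open>x \<in> Y\<close>] K x la by (intro PIstar_disjoint[OF a, of _ _ "Inl x"]) auto
    ultimately show "K \<in> (\<lambda>y. {Inl y, Inr (\<pi> y)}) ` Y" by (auto simp: \<pi>_def)
  qed (use f in \<open>auto simp: \<pi>_def\<close>)
  have "\<Union>(lines a) = Inl ` Y \<union> Inr ` Y"
    using permutes_image[OF perm] unfolding lines by auto
  then have "carrier n - \<Union>(lines a) = Inl ` ({1..n} - Y) \<union> Inr ` ({1..n} - Y)"
    by (auto simp: carrier_def)
  then have "a = perm_elem n Y \<pi>"
    using PIstar_eq_lines_points[OF a] lines by (simp add: perm_elem_def)
  then show ?thesis using perm by blast
qed

lemma elems_of_H_rel_Pow:
  assumes "Y \<subseteq> {1..n}"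
  shows "elems_of n (H_rel n (Pow Y)) = {a \<in> PIstar n. \<exists>\<pi>. \<pi> permutes Y \<and> a = perm_elem n Y \<pi>}"
  using perm_elem_if_H_rel[OF _ assms] line_rel_perm_elem unfolding elems_of_def by blast

lemma elems_of_H_rel_full: "elems_of n (H_rel n (Pow {1..n})) = Sn n"
  unfolding elems_of_H_rel_Pow[OF order_refl] by (simp add: Sn_def perm_elem_def)

lemma elems_of_H_rel_minus:
  assumes t: "t \<in> {1..n}"
  shows "elems_of n (H_rel n (Pow ({1..n} - {t}))) = SY n t"
proof -
  have "{1..n} - ({1..n} - {t}) = {t}" using t by blast
  then have "perm_elem n ({1..n} - {t}) \<pi> =
      insert {Inl t} (insert {Inr t} ((\<lambda>y. {Inl y, Inr (\<pi> y)}) ` ({1..n} - {t})))" for \<pi>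
    by (auto simp: perm_elem_def)
  then show ?thesis unfolding elems_of_H_rel_Pow[OF Diff_subset] by (simp add: SY_def)
qed

section \<open>Green's classes and ranks\<close>

lemma Gclass_eq:
  assumes e: "e \<in> PIstar n" and D: "line_rel e = Id_on D"
  shows "Gclass n e = elems_of n (H_rel n D)"
proof -
  have "Rrel n a e \<and> Lrel n a e \<longleftrightarrow> Domain (line_rel a) = D \<and> Range (line_rel a) = D"
    if a: "a \<in> PIstar n" for a
  proof
    assume RL: "Rrel n a e \<and> Lrel n a e"
    have R: "Domain (line_rel b) \<subseteq> Domain (line_rel c)"
      if "b = c \<or> (\<exists>x\<in>PIstar n. b = star n c x)" "c \<in> PIstar n" for b c
      using that line_rel_star by fastforce
    have L: "Range (line_rel b) \<subseteq> Range (line_rel c)"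
      if "b = c \<or> (\<exists>x\<in>PIstar n. b = star n x c)" "c \<in> PIstar n" for b c
      using that line_rel_star by fastforce
    have "Domain (line_rel a) = Domain (line_rel e)" "Range (line_rel a) = Range (line_rel e)"
      using RL R[of a e] R[of e a] L[of a e] L[of e a] a e
      unfolding Rrel_def Lrel_def by blast+
    then show "Domain (line_rel a) = D \<and> Range (line_rel a) = D" using D by simp
  next
    assume DR: "Domain (line_rel a) = D \<and> Range (line_rel a) = D"
    have RP: "line_rel a \<in> PRel n" using line_rel_PRel[OF a] .
    \<comment> \<open>The converse relation belongs to an inverse of \<open>a\<close>; multiplying
      by it, or by \<open>e\<close>, provides all the factors that Green's relations ask
      for.\<close>
    obtain b where b: "b \<in> PIstar n" "line_rel b = (line_rel a)\<inverse>"
      using ex_elem[OF PRel_converse[OF RP]] by blast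
    have "line_rel (star n a b) = line_rel e"
      using PRel_comp_converse[OF RP] DR D b line_rel_star[OF a b(1)] by simp
    then have "e = star n a b" using line_rel_inj star_in_PIstar a b(1) e by metis
    moreover have "line_rel (star n b a) = line_rel e"
      using PRel_comp_converse[OF PRel_converse[OF RP]] DR D b line_rel_star[OF b(1) a] by simp
    then have "e = star n b a" using line_rel_inj star_in_PIstar a b(1) e by metis
    moreover have "Id_on D O line_rel a = line_rel a" "line_rel a O Id_on D = line_rel a"
      using DR by auto
    then have "line_rel (star n e a) = line_rel a" "line_rel (star n a e) = line_rel a"
      using line_rel_star[OF e a] line_rel_star[OF a e] D by simp_all
    then have "a = star n e a" "a = star n a e" using line_rel_inj star_in_PIstar a e by metis+
    ultimately show "Rrel n a e \<and> Lrel n a e" unfolding Rrel_def Lrel_def using a b(1) e by blast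
  qed
  then show ?thesis unfolding Gclass_def elems_of_def H_rel_def using line_rel_PRel by blast
qed

lemma idem_iff:
  assumes e: "e \<in> PIstar n"
  shows "idem n e \<longleftrightarrow> line_rel e = Id_on (Domain (line_rel e))"
proof -
  have "idem n e \<longleftrightarrow> line_rel e O line_rel e = line_rel e"
    using line_rel_inj[OF star_in_PIstar[OF e e] e] line_rel_star[OF e e] by (simp add: idem_def)
  moreover have "line_rel e O line_rel e = line_rel e" if "line_rel e = Id_on D" for D
    unfolding that by auto
  ultimately show ?thesis using PRel_idempotent[OF line_rel_PRel[OF e]] by metis
qed

text \<open>Turns rank into the size of a ring, so that idempotents of a given rank can be
  identified by counting.\<close>

lemma card_line_rel:
  assumes a: "a \<in> PIstar n"
  shows "card (line_rel a) = 2 ^ rank a"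
proof -
  have "inj_on (\<lambda>F. (Inl -` \<Union>F, Inr -` \<Union>F)) (Pow (lines a))"
  proof (rule inj_onI)
    fix F G assume FG: "F \<in> Pow (lines a)" "G \<in> Pow (lines a)"
      "(Inl -` \<Union>F, Inr -` \<Union>F) = (Inl -` \<Union>G, Inr -` \<Union>G)"
    then have eq: "\<Union>F = \<Union>G" using Inl_Inr_vimage by (metis prod.inject)
    have "F \<subseteq> G" if FG: "F \<subseteq> lines a" "G \<subseteq> lines a" "\<Union>F = \<Union>G" for F G
    proof
      fix K assume K: "K \<in> F"
      then have Ka: "K \<in> a" using FG(1) by (auto simp: lines_def)
      then obtain u where u: "u \<in> K" using PIstar_block_nonempty[OF a] by blast
      then obtain K' where K': "K' \<in> G" "u \<in> K'" using K FG(3) by blast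
      then have "K = K'" using PIstar_disjoint[OF a Ka _ u K'(2)] K'(1) FG(2) by (auto simp: lines_def)
      then show "K \<in> G" using K' by simp
    qed
    then show "F = G" using FG eq by (simp add: subset_antisym)
  qed
  then have "card (line_rel a) = card (Pow (lines a))" unfolding line_rel_def by (rule card_image)
  also have "\<dots> = 2 ^ card (lines a)"
    using finite_PIstar_elem[OF a] by (simp add: card_Pow lines_def)
  finally show ?thesis by (simp add: rank_def lines_def)
qed

lemma card_Id_on: "card (Id_on D) = card D"
proof -
  have "Id_on D = (\<lambda>A. (A, A)) ` D" by auto
  then show ?thesis by (simp add: card_image inj_on_def)
qed

text \<open>Membership of \<open>y\<close> repeats that of \<open>x\<close>, so deleting
  \<open>y\<close> loses no information.\<close>

lemma card_block_ring:
  assumes "x \<in> Y" "y \<in> Y" "x \<noteq> y" "finite Y"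
  shows "card (block_ring Y {x, y}) = 2 ^ (card Y - 1)"
proof -
  have "bij_betw (\<lambda>A. A - {y}) (block_ring Y {x, y}) (Pow (Y - {y}))"
    by (rule bij_betw_byWitness[where f' = "\<lambda>B. if x \<in> B then insert y B else B"])
      (use assms in \<open>auto simp: block_ring_pair\<close>)
  then have "card (block_ring Y {x, y}) = card (Pow (Y - {y}))" by (rule bij_betw_same_card)
  then show ?thesis using assms by (simp add: card_Pow)
qed

text \<open>Rank one below the size of \<open>Y\<close> makes the ring proper, so some pair is
  merged, and its size leaves room for no further merging.\<close>

lemma Gclasses_eq:
  assumes Y: "Y \<subseteq> {1..n}" "card Y = Suc r"
  shows "{Gclass n e | e. e \<in> elems_of n (M_rel n Y) \<and> idem n e \<and> rank e = r} =
    {elems_of n (H_rel n (block_ring Y {x, y})) | x y. x \<in> Y \<and> y \<in> Y \<and> x \<noteq> y}"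
    (is "?L = ?R")
proof (intro equalityI subsetI)
  have fin: "finite Y" using Y(1) finite_subset by blast
  {
    fix G assume "G \<in> ?L"
    then obtain e where e: "e \<in> PIstar n" "line_rel e \<in> M_rel n Y" "idem n e" "rank e = r"
      and G: "G = Gclass n e" by (auto simp: elems_of_def)
    define D where "D = Domain (line_rel e)"
    have D: "line_rel e = Id_on D" using idem_iff[OF e(1)] e(3) by (simp add: D_def)
    have ring: "set_ring n D" using set_ring_Domain[OF line_rel_PRel[OF e(1)]] by (simp add: D_def)
    have YD: "Y \<in> D" "D \<subseteq> Pow Y" using M_relD[OF e(2)] D by auto
    have cD: "card D = 2 ^ r" using card_line_rel[OF e(1)] D e(4) card_Id_on by metis
    have "D \<noteq> Pow Y" using cD Y(2) fin by (auto simp: card_Pow)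
    then obtain x y where xy: "x \<in> Y" "y \<in> Y" "x \<noteq> y" "indist D x y"
      using ex_indist_pair[OF ring YD] by blast
    have "D \<subseteq> block_ring Y {x, y}" using YD(2) indistD[OF xy(4)] by (auto simp: block_ring_pair)
    moreover have "finite (block_ring Y {x, y})"
      by (rule finite_subset[of _ "Pow Y"]) (use fin in \<open>auto simp: block_ring_pair\<close>)
    ultimately have "D = block_ring Y {x, y}"
      using card_block_ring[OF xy(1-3) fin] cD Y(2) by (intro card_subset_eq) auto
    then show "G \<in> ?R" using Gclass_eq[OF e(1) D] G xy by blast
  }
  {
    fix G assume "G \<in> ?R"
    then obtain x y where xy: "x \<in> Y" "y \<in> Y" "x \<noteq> y"
      and G: "G = elems_of n (H_rel n (block_ring Y {x, y}))" by blast
    have M: "Id_on (block_ring Y {x, y}) \<in> M_rel n Y" using Id_on_block_M_rel[OF Y(1) xy] by blast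
    then obtain e where e: "e \<in> PIstar n" "line_rel e = Id_on (block_ring Y {x, y})"
      using ex_elem M_relD(1) by blast
    have "idem n e" using idem_iff[OF e(1)] e(2) by simp
    moreover have "(2::nat) ^ rank e = 2 ^ r"
      using card_line_rel[OF e(1)] card_block_ring[OF xy fin] Y(2) e(2) by (simp add: card_Id_on)
    then have "rank e = r" by simp
    moreover have "e \<in> elems_of n (M_rel n Y)" using e M by (simp add: elems_of_def)
    ultimately show "G \<in> ?L" using Gclass_eq[OF e] G by blast
  }
qed

theorem mainTheorem14:
  fixes n :: nat and T :: "(nat + nat) set set set"
  assumes "n \<ge> 3"
  shows "isolated_subsemigroup n T \<longleftrightarrow>
    T \<in> {Istar n, Istar n - Sn n, Sn n}
       \<union> {Gclass n e | e. e \<in> Istar n \<and> idem n e \<and> rank e = n - 1}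
       \<union> (\<Union>t\<in>{1..n}. {IY n t, IY n t - SY n t, SY n t}
             \<union> {Gclass n e | e. e \<in> IY n t \<and> idem n e \<and> rank e = n - 2})
       \<union> {PIstar n, PIstar n - Sn n}"
proof -
  \<comment> \<open>\<open>F Y\<close> collects the candidates of one \<open>Y\<close>, so that
    families (1) and (2) are instances of a single description. The ranks n - 1 and n - 2 are both
    \<open>card Y - 1\<close>.\<close>
  define F where "F Y = {elems_of n (M_rel n Y), elems_of n (M_rel n Y) - elems_of n (H_rel n (Pow Y)),
      elems_of n (H_rel n (Pow Y))}
    \<union> {elems_of n (H_rel n (block_ring Y {x, y})) | x y. x \<in> Y \<and> y \<in> Y \<and> x \<noteq> y}" for Y
  have F_full: "F {1..n} = {Istar n, Istar n - Sn n, Sn n}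
      \<union> {Gclass n e | e. e \<in> Istar n \<and> idem n e \<and> rank e = n - 1}"
    using Gclasses_eq[of "{1..n}" n "n - 1"] assms
    unfolding F_def elems_of_M_rel_full elems_of_H_rel_full by simp
  have F_minus: "F ({1..n} - {t}) = {IY n t, IY n t - SY n t, SY n t}
      \<union> {Gclass n e | e. e \<in> IY n t \<and> idem n e \<and> rank e = n - 2}" if t: "t \<in> {1..n}" for t
  proof -
    have "card ({1..n} - {t}) = Suc (n - 2)" using t assms by simp
    then show ?thesis
      using Gclasses_eq[of "{1..n} - {t}" n "n - 2"]
      unfolding F_def elems_of_M_rel_minus[OF t] elems_of_H_rel_minus[OF t] by auto
  qed
  define P where "P Y S \<longleftrightarrow> S = M_rel n Y \<or> S = M_rel n Y - H_rel n (Pow Y) \<or> S = H_rel n (Pow Y) \<or>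
      (\<exists>x\<in>Y. \<exists>y\<in>Y. x \<noteq> y \<and> S = H_rel n (block_ring Y {x, y}))" for Y S
  have F: "T \<in> F Y \<longleftrightarrow> (\<exists>S. P Y S \<and> T = elems_of n S)" for Y
    unfolding F_def P_def elems_of_Diff[symmetric] by (simp add: ex_disj_distrib conj_disj_distribR) blast
  have "isolated_subsemigroup n T \<longleftrightarrow> T = elems_of n (PRel n) \<or>
      T = elems_of n (PRel n - H_rel n (Pow {1..n})) \<or>
      (\<exists>Y. (Y = {1..n} \<or> (\<exists>t\<in>{1..n}. Y = {1..n} - {t})) \<and> T \<in> F Y)"
    unfolding isolated_subsemigroup_iff isolated_rels_iff[OF assms] P_def[symmetric] F by blast
  also have "\<dots> \<longleftrightarrow> T \<in> F {1..n} \<union> (\<Union>t\<in>{1..n}. F ({1..n} - {t})) \<union> {PIstar n, PIstar n - Sn n}"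
    unfolding elems_of_Diff elems_of_PRel elems_of_H_rel_full
    by (simp only: Un_iff UN_iff insert_iff empty_iff) blast
  also have "(\<Union>t\<in>{1..n}. F ({1..n} - {t})) = (\<Union>t\<in>{1..n}. {IY n t, IY n t - SY n t, SY n t}
      \<union> {Gclass n e | e. e \<in> IY n t \<and> idem n e \<and> rank e = n - 2})"
    by (intro SUP_cong refl F_minus)
  finally show ?thesis unfolding F_full .
qed

end
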